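(* Let $(W,S)$ be a Coxeter system with $S$ finite, and let $\mathscr{P}$ be a locally constant, convex and gated partition of $W$. If the simple refinements algorithm applied to $\mathscr{P}$ terminates in finite time, then the regular completion $\widehat{\mathscr{P}}$ is gated and convex.
   Context: $\ell$ is the length function, $D_L(w)=\{s\in S\mid \ell(sw)=\ell(w)-1\}$, and $x\preccurlyeq y$ means $\ell(x^{-1}y)=\ell(y)-\ell(x)$ (right weak order). A partition of $W$ is a set of nonempty pairwise disjoint subsets (parts) with union $W$; $\mathscr{P}\leq\mathscr{P}'$ means each part of $\mathscr{P}'$ is contained in a part of $\mathscr{P}$. A partition is locally constant if $D_L$ is constant on each part $P$ (common value $D_L(P)$). It is regular if it is locally constant and, for each part $P$ and $s\in S\setminus D_L(P)$, $sP\subseteq P'$ for some part $P'$. A subset $X\subseteq W$ is convex if for all $x,y\in X$ and all reduced expressions $x^{-1}y=s_1\cdots s_n$, each $xs_1\cdots s_j$ ($0\le j\le n$) is in $X$. A subset $X\subseteq W$ is gated if there is $g\in X$ with $g\preccurlyeq x$ for all $x\in X$. A partition is convex (respectively gated) if all of its parts are. The set $\mathscr{P}_{\mathrm{reg}}(W)$ of regular partitions, ordered by $\leq$, is a complete lattice, and the regular completion of $\mathscr{P}$ is $\widehat{\mathscr{P}}=\bigwedge\{\mathscr{R}\in\mathscr{P}_{\mathrm{reg}}(W)\mid\mathscr{P}\leq\mathscr{R}\}$ (meet in $\mathscr{P}_{\mathrm{reg}}(W)$). Simple refinement: let $\mathscr{P}$ be locally constant, and let $(P,s)\in\mathscr{P}\times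 S$ with $s\notin D_L(P)$ and $sP$ not contained in any part of $\mathscr{P}$. Let $X=\{P'\in\mathscr{P}\mid P'\cap sP\neq\emptyset\}$. The simple refinement of $\mathscr{P}$ based at $(P,s)$ is obtained by replacing the part $P$ by the parts $P\cap sP'$, $P'\in X$. Simple refinements algorithm with input $\mathscr{P}$: let $\mathscr{P}_0$ be the coarsest common refinement of $\mathscr{P}$ and the partition of $W$ according to left descent sets (so $\mathscr{P}_0=\mathscr{P}$ if $\mathscr{P}$ is locally constant). For $j\ge1$, if there exists a pair $(P,s)$ with $P\in\mathscr{P}_{j-1}$, $s\in S\setminus D_L(P)$ and $sP$ not contained in any part of $\mathscr{P}_{j-1}$, choose one (arbitrarily) and let $\mathscr{P}_j$ be the simple refinement of $\mathscr{P}_{j-1}$ based at it; otherwise stop. A run (with a given sequence of choices) terminates in finite time if it stops after finitely many steps. *)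

theory Defs
  imports
    "HOL-Algebra.Coset"
    "HOL-Library.Disjoint_Sets"
    "HOL-Library.Extended_Nat"
begin

section \<open>Group presentations and Coxeter systems\<close>

text \<open>Group words over \<open>S\<close> are lists of letters \<open>(s, e)\<close>, where \<open>(s, True)\<close> stands for
  \<open>s\<close> and \<open>(s, False)\<close> for the formal inverse of \<open>s\<close>.\<close>

fun eval_letter :: "('a, 'b) monoid_scheme \<Rightarrow> 'a \<times> bool \<Rightarrow> 'a" where
  "eval_letter G (s, e) = (if e then s else inv\<^bsub>G\<^esub> s)"

definition eval_word :: "('a, 'b) monoid_scheme \<Rightarrow> 'a list \<Rightarrow> 'a" where
  "eval_word G ws = foldr (\<otimes>\<^bsub>G\<^esub>) ws \<one>\<^bsub>G\<^esub>"

definition eval_group_word :: "('a, 'b) monoid_scheme \<Rightarrow> ('a \<times> bool) list \<Rightarrow> 'a" where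
  "eval_group_word G u = eval_word G (map (eval_letter G) u)"

text \<open>The congruence on group words over \<open>S\<close> whose classes are the elements of the group
  presented by the generators \<open>S\<close> and the relators \<open>R\<close>.\<close>

inductive presentation_equiv ::
  "'a set \<Rightarrow> ('a \<times> bool) list set \<Rightarrow> ('a \<times> bool) list \<Rightarrow> ('a \<times> bool) list \<Rightarrow> bool"
  for S :: "'a set" and R :: "('a \<times> bool) list set"
where
  refl: "u \<in> lists (S \<times> UNIV) \<Longrightarrow> presentation_equiv S R u u"
| sym: "presentation_equiv S R u v \<Longrightarrow> presentation_equiv S R v u"
| trans: "presentation_equiv S R u v \<Longrightarrow> presentation_equiv S R v w
    \<Longrightarrow> presentation_equiv S R u w"
| cancel: "u \<in> lists (S \<times> UNIV) \<Longrightarrow> v \<in> lists (S \<times> UNIV) \<Longrightarrow> s \<in> S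
    \<Longrightarrow> presentation_equiv S R (u @ [(s, e), (s, \<not> e)] @ v) (u @ v)"
| relator: "u \<in> lists (S \<times> UNIV) \<Longrightarrow> v \<in> lists (S \<times> UNIV) \<Longrightarrow> r \<in> R
    \<Longrightarrow> r \<in> lists (S \<times> UNIV) \<Longrightarrow> presentation_equiv S R (u @ r @ v) (u @ v)"

text \<open>The evaluation map from the presented group to \<open>G\<close> is well defined and bijective.\<close>

definition has_presentation ::
  "('a, 'b) monoid_scheme \<Rightarrow> 'a set \<Rightarrow> ('a \<times> bool) list set \<Rightarrow> bool" where
  "has_presentation G S R \<longleftrightarrow>
     group G \<and> S \<subseteq> carrier G \<and>
     eval_group_word G ` lists (S \<times> UNIV) = carrier G \<and>
     (\<forall>u \<in> lists (S \<times> UNIV). \<forall>v \<in> lists (S \<times> UNIV).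
        eval_group_word G u = eval_group_word G v \<longleftrightarrow> presentation_equiv S R u v)"

definition coxeter_matrix :: "'a set \<Rightarrow> ('a \<Rightarrow> 'a \<Rightarrow> enat) \<Rightarrow> bool" where
  "coxeter_matrix S m \<longleftrightarrow>
     (\<forall>s\<in>S. m s s = 1) \<and>
     (\<forall>s\<in>S. \<forall>t\<in>S. m s t = m t s \<and> (s \<noteq> t \<longrightarrow> m s t \<ge> 2))"

definition coxeter_relators ::
  "'a set \<Rightarrow> ('a \<Rightarrow> 'a \<Rightarrow> enat) \<Rightarrow> ('a \<times> bool) list set" where
  "coxeter_relators S m =
     {concat (replicate k [(s, True), (t, True)]) |k s t. s \<in> S \<and> t \<in> S \<and> m s t = enat k}"

definition coxeter_system :: "('a, 'b) monoid_scheme \<Rightarrow> 'a set \<Rightarrow> bool" where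
  "coxeter_system W S \<longleftrightarrow>
     (\<exists>m. coxeter_matrix S m \<and> has_presentation W S (coxeter_relators S m))"


section \<open>Length, descents and the right weak order\<close>

definition word_length :: "('a, 'b) monoid_scheme \<Rightarrow> 'a set \<Rightarrow> 'a \<Rightarrow> nat" where
  "word_length W S w = (LEAST n. \<exists>ws \<in> lists S. eval_word W ws = w \<and> length ws = n)"

definition reduced_expression ::
  "('a, 'b) monoid_scheme \<Rightarrow> 'a set \<Rightarrow> 'a \<Rightarrow> 'a list \<Rightarrow> bool" where
  "reduced_expression W S w ws \<longleftrightarrow>
     ws \<in> lists S \<and> eval_word W ws = w \<and> length ws = word_length W S w"

definition left_descents :: "('a, 'b) monoid_scheme \<Rightarrow> 'a set \<Rightarrow> 'a \<Rightarrow> 'a set" where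
  "left_descents W S w =
     {s \<in> S. int (word_length W S (s \<otimes>\<^bsub>W\<^esub> w)) = int (word_length W S w) - 1}"

definition right_weak_le :: "('a, 'b) monoid_scheme \<Rightarrow> 'a set \<Rightarrow> 'a \<Rightarrow> 'a \<Rightarrow> bool" where
  "right_weak_le W S x y \<longleftrightarrow>
     int (word_length W S (inv\<^bsub>W\<^esub> x \<otimes>\<^bsub>W\<^esub> y))
       = int (word_length W S y) - int (word_length W S x)"

definition convex_subset :: "('a, 'b) monoid_scheme \<Rightarrow> 'a set \<Rightarrow> 'a set \<Rightarrow> bool" where
  "convex_subset W S X \<longleftrightarrow>
     (\<forall>x\<in>X. \<forall>y\<in>X. \<forall>ws. reduced_expression W S (inv\<^bsub>W\<^esub> x \<otimes>\<^bsub>W\<^esub> y) ws \<longrightarrow>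
        (\<forall>j \<le> length ws. x \<otimes>\<^bsub>W\<^esub> eval_word W (take j ws) \<in> X))"

definition gated_subset :: "('a, 'b) monoid_scheme \<Rightarrow> 'a set \<Rightarrow> 'a set \<Rightarrow> bool" where
  "gated_subset W S X \<longleftrightarrow> (\<exists>g\<in>X. \<forall>x\<in>X. right_weak_le W S g x)"


section \<open>Partitions\<close>

definition convex_partition :: "('a, 'b) monoid_scheme \<Rightarrow> 'a set \<Rightarrow> 'a set set \<Rightarrow> bool" where
  "convex_partition W S \<P> \<longleftrightarrow> (\<forall>P\<in>\<P>. convex_subset W S P)"

definition gated_partition :: "('a, 'b) monoid_scheme \<Rightarrow> 'a set \<Rightarrow> 'a set set \<Rightarrow> bool" where
  "gated_partition W S \<P> \<longleftrightarrow> (\<forall>P\<in>\<P>. gated_subset W S P)"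

definition locally_constant :: "('a, 'b) monoid_scheme \<Rightarrow> 'a set \<Rightarrow> 'a set set \<Rightarrow> bool" where
  "locally_constant W S \<P> \<longleftrightarrow>
     (\<forall>P\<in>\<P>. \<forall>x\<in>P. \<forall>y\<in>P. left_descents W S x = left_descents W S y)"

text \<open>The common value of the left descent set on a part; only meaningful for a nonempty set
  on which the left descent set is constant.\<close>

definition part_descents :: "('a, 'b) monoid_scheme \<Rightarrow> 'a set \<Rightarrow> 'a set \<Rightarrow> 'a set" where
  "part_descents W S P = the_elem (left_descents W S ` P)"

definition regular :: "('a, 'b) monoid_scheme \<Rightarrow> 'a set \<Rightarrow> 'a set set \<Rightarrow> bool" where
  "regular W S \<P> \<longleftrightarrow>
     locally_constant W S \<P> \<and>
     (\<forall>P\<in>\<P>. \<forall>s \<in> S - part_descents W S P. \<exists>P'\<in>\<P>. s <#\<^bsub>W\<^esub> P \<subseteq> P')"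

text \<open>The order on partitions places finer partitions higher: \<open>\<P> \<le> \<Q>\<close> means that \<open>\<Q>\<close>
  refines \<open>\<P>\<close>.\<close>

definition partition_le ::
  "('a, 'b) monoid_scheme \<Rightarrow> 'a set set \<Rightarrow> 'a set set \<Rightarrow> bool" where
  "partition_le W \<P> \<Q> \<longleftrightarrow> refines (carrier W) \<Q> \<P>"

definition regular_partitions ::
  "('a, 'b) monoid_scheme \<Rightarrow> 'a set \<Rightarrow> 'a set set gorder" where
  "regular_partitions W S =
     \<lparr>carrier = {\<R>. partition_on (carrier W) \<R> \<and> regular W S \<R>},
      eq = (=),
      le = partition_le W\<rparr>"

definition regular_completion ::
  "('a, 'b) monoid_scheme \<Rightarrow> 'a set \<Rightarrow> 'a set set \<Rightarrow> 'a set set" where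
  "regular_completion W S \<P> =
     \<Sqinter>\<^bsub>regular_partitions W S\<^esub> {\<R> \<in> carrier (regular_partitions W S). partition_le W \<P> \<R>}"


section \<open>The simple refinements algorithm\<close>

definition refinable_at ::
  "('a, 'b) monoid_scheme \<Rightarrow> 'a set \<Rightarrow> 'a set set \<Rightarrow> 'a set \<Rightarrow> 'a \<Rightarrow> bool" where
  "refinable_at W S \<P> P s \<longleftrightarrow>
     P \<in> \<P> \<and> s \<in> S - part_descents W S P \<and> \<not> (\<exists>P'\<in>\<P>. s <#\<^bsub>W\<^esub> P \<subseteq> P')"

definition simple_refinement ::
  "('a, 'b) monoid_scheme \<Rightarrow> 'a set set \<Rightarrow> 'a set \<Rightarrow> 'a \<Rightarrow> 'a set set" where
  "simple_refinement W \<P> P s =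
     (\<P> - {P}) \<union> {P \<inter> (s <#\<^bsub>W\<^esub> P') |P'. P' \<in> \<P> \<and> P' \<inter> (s <#\<^bsub>W\<^esub> P) \<noteq> {}}"

definition descent_partition :: "('a, 'b) monoid_scheme \<Rightarrow> 'a set \<Rightarrow> 'a set set" where
  "descent_partition W S =
     {{x \<in> carrier W. left_descents W S x = left_descents W S w} |w. w \<in> carrier W}"

definition initial_partition ::
  "('a, 'b) monoid_scheme \<Rightarrow> 'a set \<Rightarrow> 'a set set \<Rightarrow> 'a set set" where
  "initial_partition W S \<P> = common_refinement {\<P>, descent_partition W S}"

text \<open>A run with arbitrary choices that stops after \<open>n\<close> refinements; \<open>Ps j\<close> is the partition
  after \<open>j\<close> refinements (values of \<open>Ps\<close> beyond \<open>n\<close> are irrelevant).\<close>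

definition terminating_run ::
  "('a, 'b) monoid_scheme \<Rightarrow> 'a set \<Rightarrow> 'a set set \<Rightarrow> nat \<Rightarrow> (nat \<Rightarrow> 'a set set) \<Rightarrow> bool" where
  "terminating_run W S \<P> n Ps \<longleftrightarrow>
     Ps 0 = initial_partition W S \<P> \<and>
     (\<forall>j<n. \<exists>P s. refinable_at W S (Ps j) P s \<and>
                   Ps (Suc j) = simple_refinement W (Ps j) P s) \<and>
     \<not> (\<exists>P s. refinable_at W S (Ps n) P s)"

end

theory Submission
  imports Defs
begin

text \<open>The gates propagate through a simple refinement because the right weak order has joins of
  bounded pairs. If \<open>X\<close> and \<open>Y\<close> are convex and gated by \<open>g\<close> and \<open>h\<close> and share a point \<open>z\<close>, then
  \<open>g\<close> and \<open>h\<close> lie below \<open>z\<close>, their join lies between \<open>g\<close> (or \<open>h\<close>) and every common point, and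
  convexity puts it into \<open>X \<inter> Y\<close>, where it is a gate. A simple refinement intersects
  \<open>P\<close> with translates \<open>s P'\<close>, which are again convex and gated as \<open>s\<close> is a left descent on \<open>P'\<close>.
  A regular partition refining \<open>\<P>\<close> refines every step of a run, so the final partition, being
  regular, is the regular completion.

  The weak order is analysed through inversion sets: \<open>\<ell>(x\<^sup>-\<^sup>1 y)\<close> is the size of the symmetric
  difference of the inversion sets of \<open>x\<close> and \<open>y\<close>, so the order is inclusion of inversion sets.\<close>

section \<open>Inversions of words\<close>

text \<open>The reflections \<open>s\<^sub>1 \<cdots> s\<^sub>i \<cdots> s\<^sub>1\<close> that occur an odd number of times along the word
  \<open>s\<^sub>1 \<cdots> s\<^sub>n\<close>.\<close>

fun word_inversions :: "('a, 'b) monoid_scheme \<Rightarrow> 'a list \<Rightarrow> 'a set" where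
  "word_inversions G [] = {}"
| "word_inversions G (s # ws) =
     {x \<in> carrier G. (x = s) \<noteq> (s \<otimes>\<^bsub>G\<^esub> x \<otimes>\<^bsub>G\<^esub> s \<in> word_inversions G ws)}"

lemma word_inversions_carrier: "word_inversions G ws \<subseteq> carrier G"
  by (cases ws) auto

lemma eval_word_Nil [simp]: "eval_word G [] = \<one>\<^bsub>G\<^esub>"
  and eval_word_Cons [simp]: "eval_word G (s # ws) = s \<otimes>\<^bsub>G\<^esub> eval_word G ws"
  by (simp_all add: eval_word_def)

section \<open>Evaluation of words in a group\<close>

context group
begin

lemma inv_mult_cancel [simp]:
  assumes "a \<in> carrier G" "x \<in> carrier G"
  shows "inv a \<otimes> (a \<otimes> x) = x" "a \<otimes> (inv a \<otimes> x) = x"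
  using assms by (simp_all flip: m_assoc)

lemma eval_word_closed [simp]: "ws \<in> lists (carrier G) \<Longrightarrow> eval_word G ws \<in> carrier G"
  by (induction ws) auto

lemma eval_word_append:
  "\<lbrakk>u \<in> lists (carrier G); v \<in> lists (carrier G)\<rbrakk>
    \<Longrightarrow> eval_word G (u @ v) = eval_word G u \<otimes> eval_word G v"
  by (induction u) (auto simp: m_assoc)

end

section \<open>Words in involutions and the parity of the reflections along them\<close>

locale involutory_generators = group W for W :: "('a, 'b) monoid_scheme" (structure) +
  fixes S :: "'a set"
  assumes S_carrier: "S \<subseteq> carrier W"
    and S_square: "s \<in> S \<Longrightarrow> s \<otimes> s = \<one>"
begin

lemma S_in_carrier [simp]: "s \<in> S \<Longrightarrow> s \<in> carrier W"
  using S_carrier by blast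

lemma lists_S_carrier: "ws \<in> lists S \<Longrightarrow> ws \<in> lists (carrier W)"
  using S_carrier by auto

lemma eval_word_S [simp]: "ws \<in> lists S \<Longrightarrow> eval_word W ws \<in> carrier W"
  using eval_word_closed lists_S_carrier by blast

lemma eval_word_append_S:
  "\<lbrakk>u \<in> lists S; v \<in> lists S\<rbrakk> \<Longrightarrow> eval_word W (u @ v) = eval_word W u \<otimes> eval_word W v"
  using eval_word_append lists_S_carrier by blast

lemma inv_S [simp]: "s \<in> S \<Longrightarrow> inv s = s"
  using S_square S_in_carrier inv_equality by blast

lemma S_cancel [simp]: "\<lbrakk>s \<in> S; x \<in> carrier W\<rbrakk> \<Longrightarrow> s \<otimes> (s \<otimes> x) = x"
  by (metis inv_S S_in_carrier inv_mult_cancel(1))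

text \<open>This is the cocycle identity: the reflections met along \<open>v\<close> appear in
  \<open>u @ v\<close> conjugated by the value of \<open>u\<close>, and parities add. The induction
  strips one letter and passes to the conjugate of \<open>x\<close> by it.\<close>

lemma word_inversions_append:
  assumes "u \<in> lists S" "v \<in> lists S" "x \<in> carrier W"
  shows "x \<in> word_inversions W (u @ v) \<longleftrightarrow>
    (x \<in> word_inversions W u) \<noteq>
    (inv (eval_word W u) \<otimes> x \<otimes> eval_word W u \<in> word_inversions W v)"
  using assms
proof (induction u arbitrary: x)
  case (Cons s u)
  then have "s \<in> S" "u \<in> lists S" by auto
  then show ?case
    using Cons.IH [of "s \<otimes> x \<otimes> s"] Cons.prems by (auto simp: inv_mult_group m_assoc)
qed simp

text \<open>By the cocycle identity, such an \<open>r\<close> contributes no reflection and does not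
  conjugate those of \<open>v\<close>. This is the form in which defining relators are
  discarded.\<close>

lemma word_inversions_insert_trivial:
  assumes "u \<in> lists S" "r \<in> lists S" "v \<in> lists S"
    and "eval_word W r = \<one>" "word_inversions W r = {}"
  shows "word_inversions W (u @ r @ v) = word_inversions W (u @ v)"
proof -
  have "x \<in> word_inversions W (r @ v) \<longleftrightarrow> x \<in> word_inversions W v" if "x \<in> carrier W" for x
    using word_inversions_append [of r v x] assms that by simp
  then have "x \<in> word_inversions W (u @ r @ v) \<longleftrightarrow> x \<in> word_inversions W (u @ v)"
    if "x \<in> carrier W" for x
    using word_inversions_append [of u _ x] assms that by simp
  then show ?thesis
    using word_inversions_carrier [of W] by blast
qed

section \<open>Alternating words and Coxeter relators\<close>

text \<open>With positions counted from 0, the reflection at position \<open>i\<close> of the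
  alternating word is \<open>(s \<otimes> t) [^] i \<otimes> s\<close>. Prepending \<open>s\<close>,
  \<open>t\<close> conjugates the old reflections by \<open>s \<otimes> t\<close> and moves their
  positions by two.\<close>

lemma word_inversions_alternating:
  assumes "s \<in> S" "t \<in> S" "x \<in> carrier W"
  shows "x \<in> word_inversions W (concat (replicate k [s, t])) \<longleftrightarrow>
    odd (card {i. i < 2 * k \<and> (s \<otimes> t) [^] i \<otimes> s = x})"
  using assms(3)
proof (induction k arbitrary: x)
  case (Suc k)
  define c where "c = s \<otimes> t"
  \<comment> \<open>\<open>y\<close> is \<open>inv c \<otimes> x \<otimes> c\<close>, the point at
    which the induction hypothesis for the remaining word is read.\<close>
  define y where "y = t \<otimes> (s \<otimes> x \<otimes> s) \<otimes> t"
  have c: "c \<in> carrier W" and y: "y \<in> carrier W"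
    using assms Suc.prems by (simp_all add: c_def y_def inv_mult_group)
  have x: "x = c \<otimes> y \<otimes> inv c"
    using assms Suc.prems by (simp add: y_def c_def m_assoc inv_mult_group S_square)
  have shift: "c [^] (i + 2) \<otimes> s = x \<longleftrightarrow> c [^] i \<otimes> s = y" for i :: nat
  proof -
    have "c [^] (i + 2) \<otimes> s = c \<otimes> (c [^] i \<otimes> s) \<otimes> inv c"
    proof -
      have "c [^] (i + 2) = c \<otimes> (c [^] i \<otimes> c)"
        using c nat_pow_Suc2 [of c "Suc i"] by simp
      moreover have "c \<otimes> s = s \<otimes> inv c"
        using assms by (simp add: c_def m_assoc inv_mult_group)
      ultimately show ?thesis
        using c assms by (simp add: m_assoc)
    qed
    then show ?thesis
      using x c y assms(1) by simp
  qed
  let ?A = "\<lambda>k x. {i. i < 2 * k \<and> c [^] i \<otimes> s = x}"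
  \<comment> \<open>Positions 0 and 1 carry the reflections \<open>s\<close> and
    \<open>c \<otimes> s\<close> of the two new letters; every later position is an old one plus
    two.\<close>
  have split: "?A (Suc k) x = (if x = s then {0::nat} else {}) \<union> (if x = c \<otimes> s then {1} else {})
      \<union> (\<lambda>i. i + 2) ` ?A k y"
  proof (intro Set.set_eqI)
    fix i :: nat
    consider "i = 0" | "i = 1" | j where "i = j + 2"
      by (metis One_nat_def Suc_eq_plus1 add_2_eq_Suc' not0_implies_Suc)
    then show "i \<in> ?A (Suc k) x \<longleftrightarrow>
      i \<in> (if x = s then {0::nat} else {}) \<union> (if x = c \<otimes> s then {1} else {})
        \<union> (\<lambda>i. i + 2) ` ?A k y"
    proof cases
      case 3
      then show ?thesis using shift [of j] by auto
    qed (use assms c in \<open>auto simp: image_iff\<close>)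
  qed
  have "card (?A (Suc k) x) = (if x = s then 1 else 0) + (if x = c \<otimes> s then 1 else 0)
      + card (?A k y)"
  proof -
    have "card ((\<lambda>i. i + 2) ` ?A k y) = card (?A k y)"
      by (rule card_image) (simp add: inj_on_def)
    moreover have "card (A \<union> B \<union> (\<lambda>i. i + 2) ` C) = card A + card B + card ((\<lambda>i. i + 2) ` C)"
      if "A \<subseteq> {0}" "B \<subseteq> {1}" "finite C" for A B C :: "nat set"
    proof -
      have "finite A" "finite B"
        using that finite_subset by blast+
      moreover have "A \<inter> B = {}" "(A \<union> B) \<inter> (\<lambda>i. i + 2) ` C = {}"
        using that by fastforce+
      ultimately show ?thesis
        using that(3) by (simp add: card_Un_disjoint)
    qed
    ultimately show ?thesis
      unfolding split by simp
  qed
  moreover have "s \<otimes> x \<otimes> s = t \<longleftrightarrow> x = c \<otimes> s"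
  proof
    assume "s \<otimes> x \<otimes> s = t"
    then have "c \<otimes> s = s \<otimes> (s \<otimes> x \<otimes> s) \<otimes> s"
      by (simp add: c_def)
    also have "\<dots> = x"
      using assms(1) Suc.prems by (simp add: m_assoc S_square)
    finally show "x = c \<otimes> s" by simp
  qed (use assms(1,2) in \<open>simp add: c_def m_assoc S_square\<close>)
  moreover have "x \<in> word_inversions W (concat (replicate (Suc k) [s, t])) \<longleftrightarrow>
      (x = s) \<noteq> ((s \<otimes> x \<otimes> s = t) \<noteq> (y \<in> word_inversions W (concat (replicate k [s, t]))))"
    using assms Suc.prems by (simp add: y_def)
  moreover have "odd n \<longleftrightarrow> A \<noteq> (B \<noteq> odd m)"
    if "n = (if A then 1 else 0) + (if B then 1 else 0) + m" for n m :: nat and A B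
    using that by auto
  ultimately show ?case
    using Suc.IH [OF y] unfolding c_def [symmetric] by blast
qed simp

text \<open>If \<open>(s t)\<^sup>k = 1\<close>, the sequence of \<open>2 k\<close> reflections of the relator runs twice through the
  same \<open>k\<close> values, so each reflection occurs an even number of times.\<close>

lemma word_inversions_relator:
  assumes "s \<in> S" "t \<in> S" "(s \<otimes> t) [^] k = \<one>"
  shows "word_inversions W (concat (replicate k [s, t])) = {}"
proof -
  have "even (card {i. i < 2 * k \<and> (s \<otimes> t) [^] i \<otimes> s = x})" for x
  proof -
    let ?A = "{i. i < k \<and> (s \<otimes> t) [^] i \<otimes> s = x}"
    have per: "(s \<otimes> t) [^] (i + k) = (s \<otimes> t) [^] i" for i :: nat
      using assms by (simp flip: nat_pow_mult)
    have "{i. i < 2 * k \<and> (s \<otimes> t) [^] i \<otimes> s = x} = ?A \<union> (\<lambda>i. i + k) ` ?A"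
    proof (intro Set.set_eqI)
      fix i :: nat
      show "i \<in> {i. i < 2 * k \<and> (s \<otimes> t) [^] i \<otimes> s = x} \<longleftrightarrow> i \<in> ?A \<union> (\<lambda>i. i + k) ` ?A"
      proof (cases "i < k")
        case False
        then obtain j where "i = j + k" by (metis add.commute le_iff_add not_less)
        then show ?thesis using per [of j] by auto
      qed auto
    qed
    moreover have "card ((\<lambda>i. i + k) ` ?A) = card ?A"
      by (rule card_image) (simp add: inj_on_def)
    moreover have "?A \<inter> (\<lambda>i. i + k) ` ?A = {}"
      by auto
    ultimately have "card {i. i < 2 * k \<and> (s \<otimes> t) [^] i \<otimes> s = x} = card ?A + card ?A"
      by (simp add: card_Un_disjoint)
    then show ?thesis by simp
  qed
  then show ?thesis
    using word_inversions_alternating [OF assms(1,2)] word_inversions_carrier [of W] by blast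
qed

lemma eval_word_alternating:
  assumes "s \<in> S" "t \<in> S"
  shows "eval_word W (concat (replicate k [s, t])) = (s \<otimes> t) [^] k"
proof (induction k)
  case (Suc k)
  then show ?case
    using assms nat_pow_Suc2 [of "s \<otimes> t" k] by (simp add: m_assoc)
qed simp

section \<open>Exchange and finiteness\<close>

text \<open>If \<open>x\<close> is the first letter, delete that letter; otherwise the conjugate of
  \<open>x\<close> by the first letter is an inversion of the tail, where a shortening is found
  recursively. The bound on \<open>set ws'\<close> keeps the new word over the same subset of
  generators, as parabolic subgroups require.\<close>

lemma exchange:
  assumes "ws \<in> lists S" "x \<in> word_inversions W ws"
  shows "\<exists>ws'. set ws' \<subseteq> set ws \<and> length ws' < length ws \<and> eval_word W ws' = x \<otimes> eval_word W ws"
  using assms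
proof (induction ws arbitrary: x)
  case (Cons s ws)
  then have s: "s \<in> S" "ws \<in> lists S" and x: "x \<in> carrier W" by auto
  show ?case
  proof (cases "x = s")
    case True
    then show ?thesis using s by (intro exI [of _ ws]) auto
  next
    case False
    with Cons obtain ws' where "set ws' \<subseteq> set ws" "length ws' < length ws"
      "eval_word W ws' = s \<otimes> x \<otimes> s \<otimes> eval_word W ws"
      by force
    then show ?thesis
      using s x by (intro exI [of _ "s # ws'"]) (auto simp: m_assoc)
  qed
qed simp

lemma word_inversions_finite: "ws \<in> lists S \<Longrightarrow> finite (word_inversions W ws)"
proof (induction ws)
  case (Cons s ws)
  have "word_inversions W (s # ws) \<subseteq> insert s ((\<lambda>x. s \<otimes> x \<otimes> s) ` word_inversions W ws)"
  proof
    fix x assume x: "x \<in> word_inversions W (s # ws)"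
    then have "x = s \<otimes> (s \<otimes> x \<otimes> s) \<otimes> s"
      using Cons.prems by (simp add: m_assoc S_square)
    then show "x \<in> insert s ((\<lambda>x. s \<otimes> x \<otimes> s) ` word_inversions W ws)"
      using x by auto
  qed
  moreover have "finite (word_inversions W ws)"
    using Cons by simp
  ultimately show ?case
    by (meson finite_imageI finite_insert finite_subset)
qed simp

end

section \<open>Inversions of elements of a Coxeter group\<close>

text \<open>These two assumptions are what the presentation is used for: generation, and inversions
  of a word depending only on its value.\<close>

locale coxeter_group = involutory_generators +
  assumes generated: "eval_word W ` lists S = carrier W"
    and word_inversions_cong: "\<lbrakk>u \<in> lists S; v \<in> lists S; eval_word W u = eval_word W v\<rbrakk>
      \<Longrightarrow> word_inversions W u = word_inversions W v"

section \<open>From the presentation to well-defined inversion sets\<close>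

text \<open>Words with equal values are linked by inserting and deleting cancelling pairs and
  relators. Each of these has value one and no inversions, so induction on
  \<open>presentation_equiv\<close> shows that inversions are preserved.\<close>

lemma coxeter_system_imp_coxeter_group:
  assumes "coxeter_system W S"
  shows "coxeter_group W S"
proof -
  obtain m where m: "coxeter_matrix S m" and pres: "has_presentation W S (coxeter_relators S m)"
    using assms unfolding coxeter_system_def by blast
  let ?R = "coxeter_relators S m"
  interpret group W
    using pres by (simp add: has_presentation_def)
  have "S \<subseteq> carrier W"
    and onto: "eval_group_word W ` lists (S \<times> UNIV) = carrier W"
    and equiv: "\<lbrakk>u \<in> lists (S \<times> UNIV); v \<in> lists (S \<times> UNIV)\<rbrakk>
      \<Longrightarrow> eval_group_word W u = eval_group_word W v \<longleftrightarrow> presentation_equiv S ?R u v" for u v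
    using pres by (auto simp: has_presentation_def)
  have relator_one: "eval_group_word W r = \<one>\<^bsub>W\<^esub>" if "r \<in> ?R" "r \<in> lists (S \<times> UNIV)" for r
  proof -
    have "presentation_equiv S ?R ([] @ r @ []) ([] @ [])"
      by (rule presentation_equiv.relator) (use that in auto)
    then have "eval_group_word W r = eval_group_word W []"
      using equiv [of r "[]"] that by simp
    then show ?thesis
      by (simp add: eval_group_word_def)
  qed
  interpret involutory_generators W S
  proof
    show "s \<otimes>\<^bsub>W\<^esub> s = \<one>\<^bsub>W\<^esub>" if "s \<in> S" for s
    proof -
      \<comment> \<open>The diagonal of the Coxeter matrix supplies the relator \<open>s s\<close>,
        which makes each generator an involution.\<close>
      have "m s s = enat 1"
        using m that by (simp add: coxeter_matrix_def one_enat_def)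
      then have "concat (replicate 1 [(s, True), (s, True)]) \<in> ?R"
        unfolding coxeter_relators_def using that by blast
      then have "eval_group_word W [(s, True), (s, True)] = \<one>\<^bsub>W\<^esub>"
        using relator_one that by simp
      then show ?thesis
        using that \<open>S \<subseteq> carrier W\<close> by (auto simp: eval_group_word_def)
    qed
  qed fact
  have eval: "eval_group_word W u = eval_word W (map fst u)" if "u \<in> lists (S \<times> UNIV)" for u
    using that by (induction u) (auto simp: eval_group_word_def)
  have fst_lists: "map fst u \<in> lists S" if "u \<in> lists (S \<times> UNIV)" for u :: "('a \<times> bool) list"
    using that by (induction u rule: list.induct) auto
  have inversions_eq: "word_inversions W (map fst u) = word_inversions W (map fst v)"
    if "presentation_equiv S ?R u v" for u v
    using that
  proof induction
    case (cancel u v s e)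
    have "word_inversions W (map fst u @ [s, s] @ map fst v)
        = word_inversions W (map fst u @ map fst v)"
    proof (rule word_inversions_insert_trivial)
      \<comment> \<open>A cancelling pair is the alternating word with \<open>t = s\<close> and
        \<open>k = 1\<close>.\<close>
      show "word_inversions W [s, s] = {}"
        using word_inversions_relator [of s s 1] cancel S_square by (simp del: word_inversions.simps)
    qed (use cancel S_square fst_lists in auto)
    then show ?case by simp
  next
    case (relator u v r)
    then obtain k s t where r: "r = concat (replicate k [(s, True), (t, True)])"
      and st: "s \<in> S" "t \<in> S"
      unfolding coxeter_relators_def by blast
    have fst_r: "map fst r = concat (replicate k [s, t])"
      unfolding r by (simp add: map_concat)
    have one: "eval_word W (map fst r) = \<one>\<^bsub>W\<^esub>"
      using relator relator_one eval by simp
    have "word_inversions W (map fst u @ map fst r @ map fst v)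
        = word_inversions W (map fst u @ map fst v)"
    proof (rule word_inversions_insert_trivial)
      show "word_inversions W (map fst r) = {}"
        using word_inversions_relator st one by (simp add: fst_r eval_word_alternating)
    qed (use relator fst_lists one in auto)
    then show ?case by simp
  qed auto
  show ?thesis
  proof
    show "eval_word W ` lists S = carrier W"
    proof
      show "carrier W \<subseteq> eval_word W ` lists S"
      proof
        fix x
        assume "x \<in> carrier W"
        then obtain u where "u \<in> lists (S \<times> UNIV)" "x = eval_group_word W u"
          using onto by blast
        then show "x \<in> eval_word W ` lists S"
          using eval fst_lists by (intro image_eqI [where x = "map fst u"]) blast+
      qed
    qed (use eval_word_S in blast)
  next
    fix u v
    assume uv: "u \<in> lists S" "v \<in> lists S" "eval_word W u = eval_word W v"
    \<comment> \<open>Words over \<open>S\<close> are read as group words with positive signs, to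
      which the presentation applies.\<close>
    define lift where "lift = map (\<lambda>s::'a. (s, True))"
    have lift: "map fst (lift w) = w" "w \<in> lists S \<Longrightarrow> lift w \<in> lists (S \<times> UNIV)" for w
      by (auto simp: lift_def o_def)
    then have "eval_group_word W (lift u) = eval_group_word W (lift v)"
      using uv by (simp only: eval)
    then have "presentation_equiv S ?R (lift u) (lift v)"
      using uv equiv lift(2) by blast
    then show "word_inversions W u = word_inversions W v"
      using inversions_eq lift(1) by metis
  qed
qed

section \<open>Inversion sets of group elements\<close>

context coxeter_group
begin

text \<open>The left inversion set. The chosen word is immaterial by
  \<open>word_inversions_cong\<close>; outside the carrier the value is unspecified.\<close>

definition inversions :: "'a \<Rightarrow> 'a set" where
  "inversions x = word_inversions W (SOME ws. ws \<in> lists S \<and> eval_word W ws = x)"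

abbreviation len :: "'a \<Rightarrow> nat" where
  "len \<equiv> word_length W S"

lemma inversions_eval_word:
  assumes "ws \<in> lists S"
  shows "inversions (eval_word W ws) = word_inversions W ws"
proof -
  let ?v = "SOME v. v \<in> lists S \<and> eval_word W v = eval_word W ws"
  have "?v \<in> lists S \<and> eval_word W ?v = eval_word W ws"
    by (rule someI [of _ ws]) (use assms in simp)
  then show ?thesis
    unfolding inversions_def using assms word_inversions_cong by blast
qed

lemma obtain_word:
  assumes "x \<in> carrier W"
  obtains ws where "ws \<in> lists S" "eval_word W ws = x"
  using assms generated by (metis imageE)

lemma inversions_carrier: "inversions x \<subseteq> carrier W"
  unfolding inversions_def by (rule word_inversions_carrier)

lemma finite_inversions [simp]: "x \<in> carrier W \<Longrightarrow> finite (inversions x)"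
  using obtain_word [of x] inversions_eval_word word_inversions_finite by metis

lemma inversions_one [simp]: "inversions \<one> = {}"
  using inversions_eval_word [of "[]"] by simp

lemma inversions_S [simp]:
  assumes "s \<in> S"
  shows "inversions s = {s}"
proof -
  have "inversions s = word_inversions W [s]"
    using inversions_eval_word [of "[s]"] assms by simp
  also have "\<dots> = {s}"
    using assms by auto
  finally show ?thesis .
qed

lemma inversions_mult:
  assumes "g \<in> carrier W" "h \<in> carrier W" "x \<in> carrier W"
  shows "x \<in> inversions (g \<otimes> h) \<longleftrightarrow> (x \<in> inversions g) \<noteq> (inv g \<otimes> x \<otimes> g \<in> inversions h)"
proof -
  obtain u v where u: "u \<in> lists S" "eval_word W u = g" and v: "v \<in> lists S" "eval_word W v = h"
    using assms obtain_word by metis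
  then have "inversions (g \<otimes> h) = word_inversions W (u @ v)"
    using inversions_eval_word [of "u @ v"] by (simp add: eval_word_append_S)
  then show ?thesis
    using word_inversions_append [of u v x] u v assms inversions_eval_word by metis
qed

section \<open>Shortest words and length\<close>

text \<open>Minimality is taken among words over \<open>J\<close> rather than over \<open>S\<close>,
  so that one argument serves both the whole group and its parabolic subgroups.\<close>

definition shortest_word :: "'a set \<Rightarrow> 'a list \<Rightarrow> bool" where
  "shortest_word J ws \<longleftrightarrow> ws \<in> lists J \<and>
     (\<forall>v \<in> lists J. eval_word W v = eval_word W ws \<longrightarrow> length ws \<le> length v)"

text \<open>Were \<open>s\<close> an inversion of the tail, exchange would write the same element by
  a word over \<open>J\<close> shorter than the tail.\<close>

lemma shortest_word_Cons:
  assumes "J \<subseteq> S" "shortest_word J (s # ws)"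
  shows "s \<in> J" "shortest_word J ws" "s \<notin> word_inversions W ws"
proof -
  have J: "s \<in> J" "ws \<in> lists J"
    and least: "\<And>v. \<lbrakk>v \<in> lists J; eval_word W v = s \<otimes> eval_word W ws\<rbrakk>
      \<Longrightarrow> length (s # ws) \<le> length v"
    using assms(2) by (auto simp: shortest_word_def)
  then have ws: "ws \<in> lists S"
    using assms(1) by auto
  show "s \<in> J" by fact
  show "shortest_word J ws"
    unfolding shortest_word_def
  proof (intro conjI ballI impI)
    fix v assume "v \<in> lists J" "eval_word W v = eval_word W ws"
    then show "length ws \<le> length v"
      using least [of "s # v"] J(1) by simp
  qed fact
  show "s \<notin> word_inversions W ws"
  proof
    assume "s \<in> word_inversions W ws"
    with ws obtain v where "set v \<subseteq> set ws" "length v < length ws"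
      "eval_word W v = s \<otimes> eval_word W ws"
      using exchange by blast
    moreover from this have "v \<in> lists J"
      using J by (auto simp: in_lists_conv_set)
    ultimately show False
      using least [of v] by auto
  qed
qed

text \<open>Since \<open>s\<close> is not an inversion of the tail, prepending it conjugates the old
  inversions by \<open>s\<close> and adds exactly one new one, namely \<open>s\<close>.\<close>

lemma card_word_inversions_shortest:
  assumes "J \<subseteq> S" "shortest_word J ws"
  shows "card (word_inversions W ws) = length ws"
  using assms(2)
proof (induction ws)
  case (Cons s ws)
  note Cons' = shortest_word_Cons [OF assms(1) Cons.prems]
  have s: "s \<in> S" and ws: "ws \<in> lists S" and notin: "s \<notin> word_inversions W ws"
    using Cons' assms(1) by (auto simp: shortest_word_def)
  let ?f = "\<lambda>x. s \<otimes> x \<otimes> s"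
  have ff: "?f (?f x) = x" if "x \<in> carrier W" for x
    using that s by (simp add: m_assoc S_square)
  have "word_inversions W (s # ws) = insert s (?f ` word_inversions W ws)"
  proof (intro Set.set_eqI)
    fix x
    have sss: "?f s = s" using s by (simp add: m_assoc)
    show "x \<in> word_inversions W (s # ws) \<longleftrightarrow> x \<in> insert s (?f ` word_inversions W ws)"
    proof (cases "x \<in> carrier W")
      case True
      then have "x \<in> ?f ` word_inversions W ws \<longleftrightarrow> ?f x \<in> word_inversions W ws"
        using ff word_inversions_carrier [of W ws] by (metis (no_types, lifting) image_iff subsetD)
      then show ?thesis
        using True notin sss by auto
    next
      case False
      then show ?thesis
        using s word_inversions_carrier [of W ws] by auto
    qed
  qed
  moreover have "s \<notin> ?f ` word_inversions W ws"
  proof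
    assume "s \<in> ?f ` word_inversions W ws"
    then obtain x where "x \<in> word_inversions W ws" "s = ?f x" by blast
    then show False
      using notin ff [of x] s word_inversions_carrier [of W ws] by (auto simp: m_assoc)
  qed
  moreover have "inj_on ?f (word_inversions W ws)"
    using ff word_inversions_carrier [of W ws] by (metis (no_types, lifting) inj_on_def subsetD)
  ultimately show ?case
    using Cons.IH Cons'(2) ws word_inversions_finite by (simp add: card_image)
qed simp

lemma obtain_shortest_word:
  assumes "x \<in> eval_word W ` lists J"
  obtains ws where "shortest_word J ws" "eval_word W ws = x"
proof -
  from assms obtain w where "w \<in> lists J \<and> eval_word W w = x" by blast
  from ex_has_least_nat [where P = "\<lambda>w. w \<in> lists J \<and> eval_word W w = x" and m = length, OF this]
  show thesis
    using that unfolding shortest_word_def by blast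
qed

lemma len_eq_card_inversions:
  assumes "x \<in> carrier W"
  shows "len x = card (inversions x)"
proof -
  obtain ws where shortest: "shortest_word S ws" and x: "eval_word W ws = x"
    using obtain_shortest_word [of x S] assms generated by blast
  then have ws: "ws \<in> lists S"
    by (simp add: shortest_word_def)
  have "len x = length ws"
    unfolding word_length_def by (rule Least_equality) (use ws x shortest in \<open>auto simp: shortest_word_def\<close>)
  also have "\<dots> = card (word_inversions W ws)"
    using card_word_inversions_shortest [OF subset_refl] shortest by simp
  finally show ?thesis
    using inversions_eval_word ws x by metis
qed

lemma len_eval_word_le: "ws \<in> lists S \<Longrightarrow> len (eval_word W ws) \<le> length ws"
  unfolding word_length_def by (rule Least_le) auto

lemma obtain_reduced_expression:
  assumes "x \<in> carrier W"
  obtains ws where "reduced_expression W S x ws"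
proof -
  have "\<exists>n. \<exists>ws \<in> lists S. eval_word W ws = x \<and> length ws = n"
    using assms obtain_word by metis
  from LeastI_ex [OF this] show thesis
    using that unfolding reduced_expression_def word_length_def by metis
qed

lemma len_mult_inversion_less:
  assumes "x \<in> inversions w" "w \<in> carrier W"
  shows "len (x \<otimes> w) < len w"
proof -
  obtain ws where ws: "reduced_expression W S w ws"
    using obtain_reduced_expression assms(2) by blast
  then have "x \<in> word_inversions W ws"
    using assms(1) inversions_eval_word unfolding reduced_expression_def by metis
  then obtain v where "set v \<subseteq> set ws" "length v < length ws" "eval_word W v = x \<otimes> w"
    using exchange ws unfolding reduced_expression_def by metis
  moreover from this have "v \<in> lists S"
    using ws by (auto simp: reduced_expression_def in_lists_conv_set)
  ultimately show ?thesis
    using len_eval_word_le [of v] ws by (auto simp: reduced_expression_def)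
qed

text \<open>Apply the cocycle identity to \<open>h = g \<otimes> (inv g \<otimes> h)\<close>:
  conjugation by \<open>g\<close> carries the inversions of \<open>inv g \<otimes> h\<close>
  bijectively onto the symmetric difference.\<close>

lemma len_inv_mult:
  assumes "g \<in> carrier W" "h \<in> carrier W"
  shows "len (inv g \<otimes> h) = card (sym_diff (inversions g) (inversions h))"
proof -
  let ?f = "\<lambda>x. g \<otimes> x \<otimes> inv g"
  have conj: "inv g \<otimes> x \<otimes> g \<in> carrier W" "?f (inv g \<otimes> x \<otimes> g) = x" "inv g \<otimes> ?f x \<otimes> g = x"
    if "x \<in> carrier W" for x
    using that assms by (simp_all add: m_assoc)
  have "sym_diff (inversions g) (inversions h) = ?f ` inversions (inv g \<otimes> h)"
  proof (intro Set.set_eqI)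
    fix x
    show "x \<in> sym_diff (inversions g) (inversions h) \<longleftrightarrow> x \<in> ?f ` inversions (inv g \<otimes> h)"
    proof (cases "x \<in> carrier W")
      case True
      have "x \<in> inversions (g \<otimes> (inv g \<otimes> h)) \<longleftrightarrow>
          (x \<in> inversions g) \<noteq> (inv g \<otimes> x \<otimes> g \<in> inversions (inv g \<otimes> h))"
        by (rule inversions_mult) (use True assms in auto)
      then have "x \<in> sym_diff (inversions g) (inversions h) \<longleftrightarrow>
          inv g \<otimes> x \<otimes> g \<in> inversions (inv g \<otimes> h)"
        using assms by auto
      also have "\<dots> \<longleftrightarrow> x \<in> ?f ` inversions (inv g \<otimes> h)"
      proof
        assume "inv g \<otimes> x \<otimes> g \<in> inversions (inv g \<otimes> h)"
        then show "x \<in> ?f ` inversions (inv g \<otimes> h)"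
          using conj(2) [OF True] by (intro image_eqI) simp_all
      next
        assume "x \<in> ?f ` inversions (inv g \<otimes> h)"
        then obtain y where y: "y \<in> inversions (inv g \<otimes> h)" "x = ?f y"
          by blast
        moreover from y have "y \<in> carrier W"
          using inversions_carrier by blast
        ultimately show "inv g \<otimes> x \<otimes> g \<in> inversions (inv g \<otimes> h)"
          using conj(3) [of y] by simp
      qed
      finally show ?thesis .
    next
      case False
      moreover have "?f y \<in> carrier W" if "y \<in> inversions (inv g \<otimes> h)" for y
        using that inversions_carrier assms by (meson inv_closed m_closed subsetD)
      ultimately show ?thesis
        using inversions_carrier by blast
    qed
  qed
  moreover have "inj_on ?f (inversions (inv g \<otimes> h))"
    using conj(3) inversions_carrier by (intro inj_on_inverseI [where g = "\<lambda>x. inv g \<otimes> x \<otimes> g"]) blast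
  ultimately show ?thesis
    using assms by (simp add: len_eq_card_inversions card_image)
qed

section \<open>Weak order and descents through inversion sets\<close>

text \<open>The size of the symmetric difference exceeds \<open>card ?B - card ?A\<close> by twice
  \<open>card (?A - ?B)\<close>, so equality says that \<open>?A - ?B\<close> is empty.\<close>

lemma right_weak_le_iff:
  assumes "g \<in> carrier W" "h \<in> carrier W"
  shows "right_weak_le W S g h \<longleftrightarrow> inversions g \<subseteq> inversions h"
proof -
  let ?A = "inversions g" and ?B = "inversions h"
  have "card (sym_diff ?A ?B) = card (?A - ?B) + card (?B - ?A)"
    using assms by (intro card_Un_disjoint) auto
  moreover have "card ?A = card (?A - ?B) + card (?A \<inter> ?B)" "card ?B = card (?B - ?A) + card (?A \<inter> ?B)"
    using assms by (metis Int_commute Un_Diff_Int card_Int_Diff finite_inversions add.commute)+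
  ultimately have "right_weak_le W S g h \<longleftrightarrow> card (?A - ?B) = 0"
    using assms unfolding right_weak_le_def
    by (simp add: len_inv_mult) (auto simp: len_eq_card_inversions)
  then show ?thesis
    using assms by simp
qed

text \<open>As \<open>inversions s = {s}\<close>, multiplying by \<open>s\<close> on the left
  changes the number of inversions by one, downwards exactly when \<open>s\<close> is among
  them.\<close>

lemma mem_left_descents_iff:
  assumes "w \<in> carrier W"
  shows "s \<in> left_descents W S w \<longleftrightarrow> s \<in> S \<and> s \<in> inversions w"
proof (cases "s \<in> S")
  case True
  have len: "len (s \<otimes> w) = card (sym_diff {s} (inversions w))"
    using len_inv_mult [of s w] True assms by simp
  show ?thesis
  proof (cases "s \<in> inversions w")
    case mem: True
    then have "sym_diff {s} (inversions w) = inversions w - {s}" "card (inversions w) > 0"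
      using assms card_gt_0_iff by fastforce+
    then show ?thesis
      using mem True assms len by (simp add: left_descents_def len_eq_card_inversions)
  next
    case False
    then have "sym_diff {s} (inversions w) = insert s (inversions w)"
      by auto
    then show ?thesis
      using False True assms len by (simp add: left_descents_def len_eq_card_inversions)
  qed
qed (simp add: left_descents_def)

end

section \<open>Joins in the right weak order\<close>

context coxeter_group
begin

lemma lists_subset_S: "\<lbrakk>J \<subseteq> S; u \<in> lists J\<rbrakk> \<Longrightarrow> u \<in> lists S"
  using lists_mono by blast

section \<open>Parabolic subgroups and joins of simple reflections\<close>

definition parabolic :: "'a set \<Rightarrow> 'a set" where
  "parabolic J = eval_word W ` lists J"

lemma parabolic_carrier:
  assumes "J \<subseteq> S"
  shows "parabolic J \<subseteq> carrier W"
  using lists_subset_S [OF assms] eval_word_S unfolding parabolic_def by blast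

lemma parabolic_one: "\<one> \<in> parabolic J"
  unfolding parabolic_def by (intro image_eqI [where x = "[]"]) auto

lemma parabolic_generator:
  assumes "J \<subseteq> S" "s \<in> J"
  shows "s \<in> parabolic J"
  unfolding parabolic_def using assms by (intro image_eqI [where x = "[s]"]) auto

lemma parabolic_mult:
  assumes "J \<subseteq> S" "a \<in> parabolic J" "b \<in> parabolic J"
  shows "a \<otimes> b \<in> parabolic J"
proof -
  obtain u v where uv: "u \<in> lists J" "a = eval_word W u" "v \<in> lists J" "b = eval_word W v"
    using assms unfolding parabolic_def by blast
  then have "a \<otimes> b = eval_word W (u @ v)"
    using eval_word_append_S lists_subset_S [OF assms(1)] by simp
  then show ?thesis
    unfolding parabolic_def using uv by (intro image_eqI [where x = "u @ v"]) auto
qed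

lemma parabolic_inv:
  assumes "J \<subseteq> S" "a \<in> parabolic J"
  shows "inv a \<in> parabolic J"
proof -
  have "inv (eval_word W u) \<in> parabolic J" if "u \<in> lists J" for u
    using that
  proof (induction u rule: list.induct)
    case (Cons s u)
    then have "s \<in> J" "u \<in> lists J" "s \<in> S" "u \<in> lists S"
      using assms(1) by auto
    then show ?case
      using Cons.IH parabolic_mult parabolic_generator assms(1) by (simp add: inv_mult_group)
  qed (simp add: parabolic_one)
  then show ?thesis
    using assms(2) unfolding parabolic_def by blast
qed

lemma inversions_parabolic:
  assumes "J \<subseteq> S" "a \<in> parabolic J"
  shows "inversions a \<subseteq> parabolic J"
proof -
  have "word_inversions W u \<subseteq> parabolic J" if "u \<in> lists J" for u
    using that
  proof (induction u rule: list.induct)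
    case (Cons s u)
    then have s: "s \<in> J" "u \<in> lists J" "s \<in> S" "s \<in> parabolic J"
      using assms(1) parabolic_generator by auto
    show ?case
    proof
      fix x
      assume x: "x \<in> word_inversions W (s # u)"
      show "x \<in> parabolic J"
      proof (cases "x = s")
        case False
        then have "s \<otimes> x \<otimes> s \<in> parabolic J"
          using x Cons.IH s by auto
        then have "s \<otimes> (s \<otimes> x \<otimes> s) \<otimes> s \<in> parabolic J"
          using s assms(1) parabolic_mult by blast
        then show ?thesis
          using x s by (simp add: m_assoc S_square)
      qed (use s in simp)
    qed
  qed simp
  then show ?thesis
    using assms inversions_eval_word lists_subset_S unfolding parabolic_def by blast
qed

text \<open>Factor \<open>u\<close> as \<open>a b\<close> with \<open>b\<close> of minimal length in its coset of the parabolic subgroup: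
  a reflection in \<open>W\<^sub>J\<close> that is an inversion of \<open>b\<close> would shorten \<open>b\<close>.\<close>

lemma parabolic_part:
  assumes J: "J \<subseteq> S" and u: "u \<in> carrier W"
  obtains a where "a \<in> parabolic J" "inversions a = inversions u \<inter> parabolic J"
proof -
  \<comment> \<open>\<open>w \<otimes> u\<close> is shortest in the coset of \<open>u\<close>; it is
    the factor \<open>b\<close>, with \<open>a = inv w\<close>.\<close>
  obtain w where w: "w \<in> parabolic J"
    and least: "\<And>v. v \<in> parabolic J \<Longrightarrow> len (w \<otimes> u) \<le> len (v \<otimes> u)"
    using ex_has_least_nat [of "\<lambda>w. w \<in> parabolic J" \<one> "\<lambda>w. len (w \<otimes> u)"] parabolic_one by blast
  define a where "a = inv w"
  have wc: "w \<in> carrier W" and a: "a \<in> parabolic J" "a \<in> carrier W"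
    using w J parabolic_carrier parabolic_inv by (auto simp: a_def)
  have minimal: "y \<notin> inversions (w \<otimes> u)" if y: "y \<in> parabolic J" for y
  proof
    assume "y \<in> inversions (w \<otimes> u)"
    then have "len (y \<otimes> (w \<otimes> u)) < len (w \<otimes> u)"
      using len_mult_inversion_less wc u by simp
    moreover have "y \<in> carrier W"
      using y J parabolic_carrier by blast
    moreover have "y \<otimes> w \<in> parabolic J"
      using y w J parabolic_mult by blast
    ultimately show False
      using least [of "y \<otimes> w"] wc u by (simp add: m_assoc)
  qed
  \<comment> \<open>Conjugation by \<open>a\<close> stays inside the parabolic subgroup, so by
    minimality the second term of the cocycle identity vanishes.\<close>
  have "x \<in> inversions u \<longleftrightarrow> x \<in> inversions a" if x: "x \<in> parabolic J" for x
  proof -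
    have "x \<in> carrier W" "inv a \<otimes> x \<otimes> a \<in> parabolic J"
      using x a J parabolic_carrier by (auto intro: parabolic_mult parabolic_inv)
    then have "x \<in> inversions (a \<otimes> (w \<otimes> u)) \<longleftrightarrow> x \<in> inversions a"
      using inversions_mult [of a "w \<otimes> u" x] minimal a wc u by simp
    then show ?thesis
      using wc u by (simp add: a_def)
  qed
  then show thesis
    using that [of a] a inversions_parabolic J by blast
qed

lemma len_inv_mult_le:
  assumes "g \<in> carrier W" "h \<in> carrier W" "inversions g \<subseteq> inversions h"
  shows "len (inv g \<otimes> h) + len g = len h"
proof -
  have "sym_diff (inversions g) (inversions h) = inversions h - inversions g"
    using assms(3) by blast
  then have "len (inv g \<otimes> h) = card (inversions h - inversions g)"
    using len_inv_mult assms(1,2) by metis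
  then show ?thesis
    using assms by (simp add: len_eq_card_inversions card_Diff_subset card_mono)
qed

text \<open>Induction along a shortest word over \<open>J\<close>. If \<open>y\<close> lies below
  \<open>a\<close> and \<open>s\<close> is an inversion of \<open>a\<close> but not of
  \<open>y\<close>, then \<open>inv y \<otimes> s \<otimes> y\<close> is an inversion of
  \<open>inv y \<otimes> a\<close>. Passing from \<open>y\<close> to \<open>s \<otimes> y\<close>
  therefore shortens the remaining factor, which puts \<open>s \<otimes> y\<close> below
  \<open>a\<close>.\<close>

lemma parabolic_le:
  assumes J: "J \<subseteq> S" and a: "a \<in> carrier W" "J \<subseteq> inversions a" and x: "x \<in> parabolic J"
  shows "inversions x \<subseteq> inversions a"
proof -
  have "word_inversions W ws \<subseteq> inversions a" if "shortest_word J ws" for ws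
    using that
  proof (induction ws)
    case (Cons s ws)
    note Cons' = shortest_word_Cons [OF J Cons.prems]
    define y where "y = eval_word W ws"
    define z where "z = inv y \<otimes> a"
    have s: "s \<in> S" and ws: "ws \<in> lists S"
      using Cons' J by (auto simp: shortest_word_def)
    then have y: "y \<in> carrier W" and inv_y: "inversions y = word_inversions W ws"
      and inv_sy: "inversions (s \<otimes> y) = word_inversions W (s # ws)"
      using inversions_eval_word [of "s # ws"] inversions_eval_word [of ws] by (simp_all add: y_def)
    have z: "z \<in> carrier W" and yz: "y \<otimes> z = a"
      using y a by (simp_all add: z_def)
    have "s \<in> inversions (y \<otimes> z)" "s \<notin> inversions y"
      using Cons' a yz inv_y by auto
    then have "inv y \<otimes> s \<otimes> y \<in> inversions z"
      using inversions_mult [of y z s] y z s by simp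
    then have "len (inv y \<otimes> s \<otimes> y \<otimes> z) < len z"
      using len_mult_inversion_less z by blast
    moreover have "inv y \<otimes> s \<otimes> y \<otimes> z = inv (s \<otimes> y) \<otimes> a"
      using s y a by (simp add: z_def inv_mult_group m_assoc)
    moreover have "len z + len y = len a"
      unfolding z_def using len_inv_mult_le [of y a] y a inv_y Cons by (simp add: Cons'(2))
    moreover have "len (s \<otimes> y) = len y + 1"
      using card_word_inversions_shortest [OF J Cons.prems]
        card_word_inversions_shortest [OF J Cons'(2)] inv_y inv_sy s y
      by (simp add: len_eq_card_inversions del: word_inversions.simps)
    ultimately have lt: "len (inv (s \<otimes> y) \<otimes> a) + len (s \<otimes> y) < len a + 1"
      by simp
    \<comment> \<open>The left side of \<open>lt\<close> exceeds \<open>len a\<close> by twice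
      \<open>card (?A - ?B)\<close>, so that difference is empty.\<close>
    let ?A = "inversions (s \<otimes> y)" and ?B = "inversions a"
    have "card (sym_diff ?A ?B) = card (?A - ?B) + card (?B - ?A)"
      using s y a by (intro card_Un_disjoint) auto
    moreover have "card ?A = card (?A - ?B) + card (?A \<inter> ?B)"
      "card ?B = card (?B - ?A) + card (?A \<inter> ?B)"
      using s y a card_Int_Diff [of ?A ?B] card_Int_Diff [of ?B ?A] by (simp_all add: Int_commute)
    ultimately have "card (?A - ?B) = 0"
      using lt s y a by (simp add: len_inv_mult) (simp add: len_eq_card_inversions)
    then show ?case
      using finite_inversions [of "s \<otimes> y"] s y inv_sy by (simp del: word_inversions.simps)
  qed simp
  moreover obtain ws where "shortest_word J ws" "eval_word W ws = x"
    using x obtain_shortest_word unfolding parabolic_def by blast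
  moreover from this have "ws \<in> lists S"
    using J lists_subset_S unfolding shortest_word_def by blast
  ultimately show ?thesis
    using inversions_eval_word by metis
qed

text \<open>The join is the part of the bound \<open>u\<close> in \<open>parabolic J\<close>. For
  another bound \<open>v\<close>, its own part contains \<open>J\<close> among its inversions and so
  dominates all of \<open>parabolic J\<close>.\<close>

lemma join_of_simple:
  assumes J: "J \<subseteq> S" and u: "u \<in> carrier W" "J \<subseteq> inversions u"
  obtains a where "a \<in> carrier W" "J \<subseteq> inversions a"
    "\<And>v. \<lbrakk>v \<in> carrier W; J \<subseteq> inversions v\<rbrakk> \<Longrightarrow> inversions a \<subseteq> inversions v"
proof -
  obtain a where a: "a \<in> parabolic J" "inversions a = inversions u \<inter> parabolic J"
    using parabolic_part J u by blast
  have "inversions a \<subseteq> inversions v" if v: "v \<in> carrier W" "J \<subseteq> inversions v" for v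
  proof -
    obtain b where b: "b \<in> parabolic J" "inversions b = inversions v \<inter> parabolic J"
      using parabolic_part J v by blast
    then have "J \<subseteq> inversions b"
      using v J parabolic_generator by blast
    then have "inversions a \<subseteq> inversions b"
      using parabolic_le [of J b a] a(1) b(1) J parabolic_carrier [OF J] by blast
    then show ?thesis using b by blast
  qed
  moreover have "J \<subseteq> inversions a"
    using a u J parabolic_generator by blast
  ultimately show thesis
    using that [of a] a(1) parabolic_carrier [OF J] by blast
qed

section \<open>Left multiplication by a generator and joins\<close>

text \<open>For \<open>t \<noteq> s\<close>, being an inversion of \<open>s \<otimes> x\<close>
  means that the conjugate of \<open>t\<close> by \<open>s\<close> is one of \<open>x\<close>. Only
  \<open>t = s\<close> reverses, and there the last hypothesis makes both sides agree.\<close>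

lemma inversions_S_mult_mono:
  assumes "s \<in> S" "x \<in> carrier W" "y \<in> carrier W"
    and "inversions x \<subseteq> inversions y" "s \<in> inversions x \<longleftrightarrow> s \<in> inversions y"
  shows "inversions (s \<otimes> x) \<subseteq> inversions (s \<otimes> y)"
proof
  fix t
  assume t: "t \<in> inversions (s \<otimes> x)"
  then have tc: "t \<in> carrier W"
    using inversions_carrier by blast
  show "t \<in> inversions (s \<otimes> y)"
  proof (cases "t = s")
    case True
    then show ?thesis
      using t inversions_mult [of s x s] inversions_mult [of s y s] assms by (simp add: m_assoc S_square)
  next
    case False
    then show ?thesis
      using t tc inversions_mult [of s x t] inversions_mult [of s y t] assms by auto
  qed
qed

lemma S_inversions_S_mult:
  assumes "s \<in> S" "x \<in> carrier W"
  shows "s \<in> inversions (s \<otimes> x) \<longleftrightarrow> s \<notin> inversions x"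
  using inversions_mult [of s x s] assms by (simp add: S_square)

text \<open>The first letter of a shortest word is an inversion, as it is not one of the
  tail.\<close>

lemma obtain_S_inversion:
  assumes "x \<in> carrier W" "inversions x \<noteq> {}"
  obtains s where "s \<in> S" "s \<in> inversions x"
proof -
  obtain ws where ws: "shortest_word S ws" "eval_word W ws = x"
    using obtain_shortest_word [of x S] assms generated by blast
  then have inv: "inversions x = word_inversions W ws"
    using inversions_eval_word unfolding shortest_word_def by blast
  show thesis
  proof (cases ws)
    case Nil
    then show thesis using inv assms by simp
  next
    case (Cons s v)
    then have "s \<in> S" "s \<notin> word_inversions W v"
      using shortest_word_Cons [OF subset_refl] ws(1) by simp_all
    then show thesis
      using that [of s] inv Cons by (simp add: S_square)
  qed
qed

text \<open>The least upper bound in the right weak order, phrased by inclusion as in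
  \<open>right_weak_le_iff\<close>.\<close>

definition is_join :: "'a \<Rightarrow> 'a \<Rightarrow> 'a \<Rightarrow> bool" where
  "is_join x y j \<longleftrightarrow> j \<in> carrier W \<and> inversions x \<subseteq> inversions j \<and> inversions y \<subseteq> inversions j \<and>
     (\<forall>v \<in> carrier W. inversions x \<subseteq> inversions v \<longrightarrow> inversions y \<subseteq> inversions v
        \<longrightarrow> inversions j \<subseteq> inversions v)"

text \<open>Left multiplication by \<open>s\<close> is an order isomorphism between the elements
  having \<open>s\<close> as an inversion and those not having it, so it transports the join once
  \<open>j\<close> is known to be on the second side.\<close>

lemma is_join_S_mult:
  assumes s: "s \<in> S" "s \<in> inversions x" "s \<in> inversions y"
    and xyu: "x \<in> carrier W" "y \<in> carrier W" "u \<in> carrier W"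
      "inversions x \<subseteq> inversions u" "inversions y \<subseteq> inversions u"
    and j: "is_join (s \<otimes> x) (s \<otimes> y) j"
  shows "is_join x y (s \<otimes> j)"
proof -
  have jc: "j \<in> carrier W" and xj: "inversions (s \<otimes> x) \<subseteq> inversions j"
    and yj: "inversions (s \<otimes> y) \<subseteq> inversions j"
    using j by (simp_all add: is_join_def)
  have below: "inversions j \<subseteq> inversions (s \<otimes> v)"
    if v: "v \<in> carrier W" "inversions x \<subseteq> inversions v" "inversions y \<subseteq> inversions v" for v
  proof -
    have "inversions (s \<otimes> x) \<subseteq> inversions (s \<otimes> v)" "inversions (s \<otimes> y) \<subseteq> inversions (s \<otimes> v)"
      using inversions_S_mult_mono [of s _ v] s xyu v by blast+
    then show ?thesis
      using j s v by (simp add: is_join_def)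
  qed
  \<comment> \<open>The bound \<open>u\<close> has \<open>s\<close> as an inversion, so
    \<open>s \<otimes> u\<close> does not, and \<open>j\<close> lies below
    \<open>s \<otimes> u\<close>.\<close>
  have notin: "s \<notin> inversions j"
    using below [of u] xyu s S_inversions_S_mult [of s u] by auto
  have up: "inversions w \<subseteq> inversions (s \<otimes> j)"
    if w: "w \<in> carrier W" "s \<in> inversions w" "inversions (s \<otimes> w) \<subseteq> inversions j" for w
    using inversions_S_mult_mono [of s "s \<otimes> w" j] S_inversions_S_mult [of s w] s jc w notin by simp
  have "inversions (s \<otimes> j) \<subseteq> inversions v"
    if v: "v \<in> carrier W" "inversions x \<subseteq> inversions v" "inversions y \<subseteq> inversions v" for v
    using inversions_S_mult_mono [of s j "s \<otimes> v"] S_inversions_S_mult [of s v]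
      below [OF v] s jc v notin by auto
  then show ?thesis
    unfolding is_join_def using up xyu s xj yj jc by simp
qed

text \<open>Bounded pairs have joins: below \<open>s\<close> and \<open>t\<close> the problem is solved by the longest element of a
  finite dihedral subgroup, and two elements above a common simple reflection can be shortened.\<close>

lemma bounded_join_exists:
  assumes "x \<in> carrier W" "y \<in> carrier W" "u \<in> carrier W"
    and "inversions x \<subseteq> inversions u" "inversions y \<subseteq> inversions u"
  shows "\<exists>j. is_join x y j"
  using assms
proof (induction "len u" arbitrary: x y u rule: less_induct)
  case less
  note u = less.prems(3)
  have common: "\<exists>j. is_join x y j"
    if s: "s \<in> S" "s \<in> inversions x" "s \<in> inversions y"
      and xy: "x \<in> carrier W" "y \<in> carrier W" "inversions x \<subseteq> inversions u" "inversions y \<subseteq> inversions u"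
    for s x y
  proof -
    have "len (s \<otimes> u) < len u"
      using len_mult_inversion_less s xy u by blast
    moreover have "inversions (s \<otimes> x) \<subseteq> inversions (s \<otimes> u)" "inversions (s \<otimes> y) \<subseteq> inversions (s \<otimes> u)"
      using inversions_S_mult_mono [of s _ u] s xy u by blast+
    ultimately obtain j where "is_join (s \<otimes> x) (s \<otimes> y) j"
      using less.hyps [of "s \<otimes> u" "s \<otimes> x" "s \<otimes> y"] s xy u by auto
    then show ?thesis
      using is_join_S_mult s xy u by blast
  qed
  consider "inversions x = {}" | "inversions y = {}" | "inversions x \<noteq> {}" "inversions y \<noteq> {}"
    by blast
  then show ?case
  proof cases
    case 1
    then show ?thesis using less.prems by (intro exI [of _ y]) (simp add: is_join_def)
  next
    case 2
    then show ?thesis using less.prems by (intro exI [of _ x]) (simp add: is_join_def)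
  next
    case 3
    obtain s where s: "s \<in> S" "s \<in> inversions x"
      using obtain_S_inversion 3 less.prems by blast
    obtain t where t: "t \<in> S" "t \<in> inversions y"
      using obtain_S_inversion 3 less.prems by blast
    \<comment> \<open>\<open>a\<close> is the join of \<open>s\<close> and \<open>t\<close>. It
      shares \<open>s\<close> with \<open>x\<close>, giving their join \<open>b\<close>;
      \<open>b\<close> shares \<open>t\<close> with \<open>y\<close>, giving \<open>c\<close>. Every
      bound of \<open>x\<close> and \<open>y\<close> is above \<open>a\<close>, so \<open>c\<close>
      is their join.\<close>
    obtain a where a: "a \<in> carrier W" "s \<in> inversions a" "t \<in> inversions a"
      and a_least: "\<And>v. \<lbrakk>v \<in> carrier W; s \<in> inversions v; t \<in> inversions v\<rbrakk>
        \<Longrightarrow> inversions a \<subseteq> inversions v"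
    proof (rule join_of_simple [of "{s, t}" u])
      show "{s, t} \<subseteq> S" "{s, t} \<subseteq> inversions u"
        using s t less.prems(4,5) by auto
    qed (use less.prems(3) in auto)
    have "inversions a \<subseteq> inversions u"
      using a_least s t less.prems by blast
    then obtain b where b: "is_join x a b"
      using common [of s x a] s a less.prems by blast
    then have "inversions b \<subseteq> inversions u" "b \<in> carrier W" "t \<in> inversions b"
      using a less.prems \<open>inversions a \<subseteq> inversions u\<close> by (auto simp: is_join_def)
    then obtain c where c: "is_join b y c"
      using common [of t b y] t less.prems by blast
    have "is_join x y c"
      unfolding is_join_def
    proof (intro conjI ballI impI)
      fix v
      assume v: "v \<in> carrier W" "inversions x \<subseteq> inversions v" "inversions y \<subseteq> inversions v"
      then have "inversions a \<subseteq> inversions v"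
        using a_least s t by blast
      then show "inversions c \<subseteq> inversions v"
        using b c v by (simp add: is_join_def)
    qed (use b c in \<open>auto simp: is_join_def\<close>)
    then show ?thesis by blast
  qed
qed

section \<open>Convex and gated subsets\<close>

text \<open>Lengths add along \<open>g\<close>, \<open>j\<close>, \<open>x\<close>, so reduced
  expressions of the two steps concatenate to one for \<open>inv g \<otimes> x\<close> that passes
  through \<open>j\<close>.\<close>

lemma convex_subset_between:
  assumes X: "convex_subset W S X" "X \<subseteq> carrier W" and "g \<in> X" "x \<in> X" "j \<in> carrier W"
    and "inversions g \<subseteq> inversions j" "inversions j \<subseteq> inversions x"
  shows "j \<in> X"
proof -
  have c: "g \<in> carrier W" "x \<in> carrier W"
    using assms by auto
  obtain u where u: "reduced_expression W S (inv g \<otimes> j) u"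
    using obtain_reduced_expression c assms(5) by (meson inv_closed m_closed)
  obtain v where v: "reduced_expression W S (inv j \<otimes> x) v"
    using obtain_reduced_expression c assms(5) by (meson inv_closed m_closed)
  have "reduced_expression W S (inv g \<otimes> x) (u @ v)"
  proof -
    have "len (inv g \<otimes> x) = len (inv g \<otimes> j) + len (inv j \<otimes> x)"
      using len_inv_mult_le [of g j] len_inv_mult_le [of j x] len_inv_mult_le [of g x] c assms
      by (smt (verit) add.assoc add.commute add_left_cancel subset_trans)
    moreover have "inv g \<otimes> j \<otimes> (inv j \<otimes> x) = inv g \<otimes> x"
      using c assms(5) by (simp add: m_assoc)
    ultimately show ?thesis
      using u v by (simp add: reduced_expression_def eval_word_append_S)
  qed
  then have "g \<otimes> eval_word W (take (length u) (u @ v)) \<in> X"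
    using X(1) assms(3,4) unfolding convex_subset_def by (metis le_add1 length_append)
  then show ?thesis
    using u c assms(5) by (simp add: reduced_expression_def)
qed

lemma convex_subset_Int:
  "\<lbrakk>convex_subset W S X; convex_subset W S Y\<rbrakk> \<Longrightarrow> convex_subset W S (X \<inter> Y)"
  unfolding convex_subset_def by blast

lemma gated_subset_Int:
  assumes X: "convex_subset W S X" "gated_subset W S X" "X \<subseteq> carrier W"
    and Y: "convex_subset W S Y" "gated_subset W S Y" "Y \<subseteq> carrier W"
    and "X \<inter> Y \<noteq> {}"
  shows "gated_subset W S (X \<inter> Y)"
proof -
  obtain g where g: "g \<in> X" "\<And>x. x \<in> X \<Longrightarrow> inversions g \<subseteq> inversions x"
    using X right_weak_le_iff unfolding gated_subset_def by (meson subsetD)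
  obtain h where h: "h \<in> Y" "\<And>x. x \<in> Y \<Longrightarrow> inversions h \<subseteq> inversions x"
    using Y right_weak_le_iff unfolding gated_subset_def by (meson subsetD)
  obtain z where z: "z \<in> X" "z \<in> Y"
    using assms by blast
  then obtain j where j: "is_join g h j"
    using bounded_join_exists [of g h z] g h X Y by blast
  have below: "inversions j \<subseteq> inversions x" if x: "x \<in> X" "x \<in> Y" for x
  proof -
    have "x \<in> carrier W"
      using x(1) X(3) by blast
    then show ?thesis
      using j g(2) [OF x(1)] h(2) [OF x(2)] by (simp add: is_join_def)
  qed
  have jc: "j \<in> carrier W" "inversions g \<subseteq> inversions j" "inversions h \<subseteq> inversions j"
    using j by (simp_all add: is_join_def)
  have "j \<in> X" "j \<in> Y"
    using convex_subset_between [OF X(1,3) g(1) z(1) jc(1,2) below [OF z]]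
      convex_subset_between [OF Y(1,3) h(1) z(2) jc(1,3) below [OF z]] .
  moreover have "right_weak_le W S j x" if "x \<in> X \<inter> Y" for x
    using right_weak_le_iff [of j x] jc(1) below [of x] that X(3) by blast
  ultimately show ?thesis
    unfolding gated_subset_def by blast
qed

end

section \<open>Simple refinements\<close>

context coxeter_group
begin

lemma mem_S_coset_iff:
  assumes "s \<in> S" "X \<subseteq> carrier W"
  shows "x \<in> s <# X \<longleftrightarrow> x \<in> carrier W \<and> s \<otimes> x \<in> X"
proof
  assume "x \<in> s <# X"
  then obtain y where "y \<in> X" "x = s \<otimes> y" "y \<in> carrier W"
    using assms unfolding l_coset_def by blast
  then show "x \<in> carrier W \<and> s \<otimes> x \<in> X"
    using assms by simp
next
  assume "x \<in> carrier W \<and> s \<otimes> x \<in> X"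
  moreover from this have "x = s \<otimes> (s \<otimes> x)"
    using assms by simp
  ultimately show "x \<in> s <# X"
    unfolding l_coset_def by blast
qed

text \<open>Left translation leaves \<open>inv x \<otimes> y\<close>, and hence its reduced
  expressions, unchanged.\<close>

lemma convex_subset_S_coset:
  assumes s: "s \<in> S" and X: "X \<subseteq> carrier W" "convex_subset W S X"
  shows "convex_subset W S (s <# X)"
  unfolding convex_subset_def
proof (intro ballI allI impI)
  fix x y ws j
  assume xy: "x \<in> s <# X" "y \<in> s <# X" and ws: "reduced_expression W S (inv x \<otimes> y) ws"
    and j: "j \<le> length ws"
  have c: "x \<in> carrier W" "y \<in> carrier W" and sX: "s \<otimes> x \<in> X" "s \<otimes> y \<in> X"
    using xy mem_S_coset_iff s X by blast+
  have "inv (s \<otimes> x) \<otimes> (s \<otimes> y) = inv x \<otimes> y"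
    using s c by (simp add: inv_mult_group m_assoc)
  then have "s \<otimes> x \<otimes> eval_word W (take j ws) \<in> X"
    using X(2) sX ws j unfolding convex_subset_def by simp
  moreover have "eval_word W (take j ws) \<in> carrier W"
    using ws by (intro eval_word_S) (auto simp: reduced_expression_def dest: in_set_takeD)
  ultimately show "x \<otimes> eval_word W (take j ws) \<in> s <# X"
    using mem_S_coset_iff s X(1) c by (simp add: m_assoc)
qed

text \<open>The translated gate \<open>s \<otimes> g\<close> works: as \<open>s\<close> is an
  inversion of every point of \<open>X\<close>, \<open>inversions_S_mult_mono\<close> preserves the
  order.\<close>

lemma gated_subset_S_coset:
  assumes s: "s \<in> S" and X: "X \<subseteq> carrier W" "gated_subset W S X"
    and desc: "\<And>x. x \<in> X \<Longrightarrow> s \<in> left_descents W S x"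
  shows "gated_subset W S (s <# X)"
proof -
  obtain g where g: "g \<in> X" "\<And>x. x \<in> X \<Longrightarrow> right_weak_le W S g x"
    using X(2) unfolding gated_subset_def by blast
  have "right_weak_le W S (s \<otimes> g) y" if y: "y \<in> s <# X" for y
  proof -
    have c: "y \<in> carrier W" "s \<otimes> y \<in> X" "g \<in> carrier W" "s \<otimes> y \<in> carrier W"
      using y g(1) mem_S_coset_iff s X(1) by auto
    have "s \<in> inversions g" "s \<in> inversions (s \<otimes> y)"
      using desc g(1) c mem_left_descents_iff by blast+
    moreover have "inversions g \<subseteq> inversions (s \<otimes> y)"
      using g(2) c right_weak_le_iff by blast
    ultimately have "inversions (s \<otimes> g) \<subseteq> inversions (s \<otimes> (s \<otimes> y))"
      using inversions_S_mult_mono s c by blast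
    then show ?thesis
      using right_weak_le_iff s c by simp
  qed
  moreover have "s \<otimes> g \<in> s <# X"
    using g(1) unfolding l_coset_def by blast
  ultimately show ?thesis
    unfolding gated_subset_def by blast
qed

lemma part_descents_eq:
  assumes "locally_constant W S \<Q>" "P \<in> \<Q>" "x \<in> P"
  shows "part_descents W S P = left_descents W S x"
proof -
  have "left_descents W S ` P = {left_descents W S x}"
    using assms unfolding locally_constant_def by blast
  then show ?thesis
    by (simp add: part_descents_def)
qed

section \<open>One refinement step\<close>

text \<open>The pieces of \<open>P\<close> are the fibres of the map sending \<open>x\<close> to the
  part that contains \<open>s \<otimes> x\<close>.\<close>

lemma partition_on_simple_refinement:
  assumes \<Q>: "partition_on (carrier W) \<Q>" and P: "P \<in> \<Q>" and s: "s \<in> S"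
  shows "partition_on (carrier W) (simple_refinement W \<Q> P s)"
proof -
  let ?\<R> = "simple_refinement W \<Q> P s"
  have sub: "X \<subseteq> carrier W" if "X \<in> \<Q>" for X
    using \<Q> that by (auto simp: partition_on_def)
  have disj: "X = Y" if "X \<in> \<Q>" "Y \<in> \<Q>" "x \<in> X" "x \<in> Y" for X Y x
    using \<Q> that unfolding partition_on_def disjoint_def by blast
  have mem: "x \<in> s <# X \<longleftrightarrow> x \<in> carrier W \<and> s \<otimes> x \<in> X" if "X \<in> \<Q>" for x X
    using mem_S_coset_iff s sub that by blast
  have coset: "Y = P \<inter> (s <# P')" if Y: "Y \<in> ?\<R>" and "x \<in> Y" "x \<in> P" "P' \<in> \<Q>" "s \<otimes> x \<in> P'" for Y x P'
  proof -
    have "Y \<notin> \<Q> - {P}"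
      using that disj [of Y P x] P by blast
    then obtain P'' where "P'' \<in> \<Q>" "Y = P \<inter> (s <# P'')"
      using Y unfolding simple_refinement_def by blast
    then show ?thesis
      using that mem [of P''] disj [of P'' P' "s \<otimes> x"] by simp
  qed
  have nonempty: "X \<noteq> {}" if X: "X \<in> ?\<R>" for X
  proof (cases "X \<in> \<Q>")
    case True
    then show ?thesis
      using \<Q> by (auto simp: partition_on_def)
  next
    case False
    then obtain P' where P': "X = P \<inter> (s <# P')" "P' \<in> \<Q>" "P' \<inter> (s <# P) \<noteq> {}"
      using X unfolding simple_refinement_def by blast
    then obtain y where "y \<in> P'" "y \<in> carrier W" "s \<otimes> y \<in> P"
      using mem P by blast
    then have "s \<otimes> y \<in> X"
      using P' mem [of P' "s \<otimes> y"] s by simp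
    then show ?thesis by blast
  qed
  show ?thesis
  proof (rule partition_onI)
    show "\<Union> ?\<R> = carrier W"
    proof
      show "\<Union> ?\<R> \<subseteq> carrier W"
        using sub P unfolding simple_refinement_def by blast
      show "carrier W \<subseteq> \<Union> ?\<R>"
      proof
        fix x
        assume x: "x \<in> carrier W"
        then have sx: "s \<otimes> x \<in> carrier W" using s by simp
        obtain Q where Q: "Q \<in> \<Q>" "x \<in> Q"
          using x \<Q> by (auto simp: partition_on_def)
        obtain P' where P': "P' \<in> \<Q>" "s \<otimes> x \<in> P'"
          using sx \<Q> by (auto simp: partition_on_def)
        show "x \<in> \<Union> ?\<R>"
        proof (cases "Q = P")
          case False
          then show ?thesis using Q unfolding simple_refinement_def by blast
        next
          case True
          then have "s \<otimes> x \<in> P' \<inter> (s <# P)" "x \<in> P \<inter> (s <# P')"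
            using P' Q x sx s mem P by auto
          then show ?thesis
            using P' unfolding simple_refinement_def by blast
        qed
      qed
    qed
  next
    fix X Y
    assume XY: "X \<in> ?\<R>" "Y \<in> ?\<R>" "X \<noteq> Y"
    show "disjnt X Y"
    proof (rule ccontr)
      assume "\<not> disjnt X Y"
      then obtain x where x: "x \<in> X" "x \<in> Y"
        by (auto simp: disjnt_def)
      show False
      proof (cases "x \<in> P")
        case True
        then have "s \<otimes> x \<in> carrier W"
          using sub [OF P] s by auto
        then obtain P' where P': "P' \<in> \<Q>" "s \<otimes> x \<in> P'"
          using \<Q> by (auto simp: partition_on_def)
        then show False
          using coset [OF XY(1) x(1) True P'] coset [OF XY(2) x(2) True P'] XY(3) by simp
      next
        case False
        then have "X \<in> \<Q>" "Y \<in> \<Q>"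
          using x XY(1,2) unfolding simple_refinement_def by blast+
        then show False
          using disj x XY(3) by blast
      qed
    qed
  qed (use nonempty in blast)
qed

text \<open>A common point \<open>y\<close> comes from \<open>s \<otimes> y\<close> in
  \<open>P\<close>, where \<open>s\<close> is no descent; so \<open>s\<close> is a descent of
  \<open>y\<close>, and local constancy spreads this over \<open>P'\<close>. It is the hypothesis
  for translating the gate of \<open>P'\<close>.\<close>

lemma refinable_coset_descents:
  assumes \<Q>: "partition_on (carrier W) \<Q>" "locally_constant W S \<Q>"
    and ref: "refinable_at W S \<Q> P s" and P': "P' \<in> \<Q>" "P' \<inter> (s <# P) \<noteq> {}" and x: "x \<in> P'"
  shows "s \<in> left_descents W S x"
proof -
  have s: "s \<in> S" and P: "P \<in> \<Q>" "P \<subseteq> carrier W"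
    using ref \<Q>(1) by (auto simp: refinable_at_def partition_on_def)
  obtain y where y: "y \<in> P'" "y \<in> carrier W" "s \<otimes> y \<in> P"
    using P' mem_S_coset_iff s P by blast
  then have "s \<notin> left_descents W S (s \<otimes> y)"
    using part_descents_eq [OF \<Q>(2) P(1)] ref unfolding refinable_at_def by blast
  then have "s \<in> left_descents W S y"
    using mem_left_descents_iff S_inversions_S_mult s y by simp
  then show ?thesis
    using \<Q>(2) P'(1) x y(1) unfolding locally_constant_def by blast
qed

lemma simple_refinement_preserves:
  assumes \<Q>: "partition_on (carrier W) \<Q>" "locally_constant W S \<Q>"
      "convex_partition W S \<Q>" "gated_partition W S \<Q>"
    and ref: "refinable_at W S \<Q> P s"
  shows "locally_constant W S (simple_refinement W \<Q> P s)"
    and "convex_partition W S (simple_refinement W \<Q> P s)"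
    and "gated_partition W S (simple_refinement W \<Q> P s)"
proof -
  have s: "s \<in> S" and P: "P \<in> \<Q>" and sub: "\<And>X. X \<in> \<Q> \<Longrightarrow> X \<subseteq> carrier W"
    using ref \<Q>(1) by (auto simp: refinable_at_def partition_on_def)
  \<comment> \<open>Nonemptiness of each new part provides the common point required by
    \<open>gated_subset_Int\<close>.\<close>
  have nonempty: "X \<noteq> {}" if "X \<in> simple_refinement W \<Q> P s" for X
    using partition_on_simple_refinement [OF \<Q>(1) P s] that by (auto simp: partition_on_def)
  have cases: "X \<in> \<Q> \<or> (\<exists>P'\<in>\<Q>. P' \<inter> (s <# P) \<noteq> {} \<and> X = P \<inter> (s <# P'))"
    if "X \<in> simple_refinement W \<Q> P s" for X
    using that unfolding simple_refinement_def by blast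
  have "\<exists>Q\<in>\<Q>. X \<subseteq> Q" if "X \<in> simple_refinement W \<Q> P s" for X
    using cases [OF that] P by blast
  then show "locally_constant W S (simple_refinement W \<Q> P s)"
    using \<Q>(2) unfolding locally_constant_def by (meson subsetD)
  have "convex_subset W S X \<and> gated_subset W S X" if X: "X \<in> simple_refinement W \<Q> P s" for X
    using cases [OF X]
  proof
    assume "X \<in> \<Q>"
    then show ?thesis
      using \<Q>(3,4) by (simp add: convex_partition_def gated_partition_def)
  next
    assume "\<exists>P'\<in>\<Q>. P' \<inter> (s <# P) \<noteq> {} \<and> X = P \<inter> (s <# P')"
    then obtain P' where P': "P' \<in> \<Q>" "P' \<inter> (s <# P) \<noteq> {}" and X_eq: "X = P \<inter> (s <# P')"
      by blast
    have convex: "convex_subset W S P" "convex_subset W S P'"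
      and gated: "gated_subset W S P" "gated_subset W S P'"
      using \<Q>(3,4) P P' by (simp_all add: convex_partition_def gated_partition_def)
    have "convex_subset W S (s <# P')"
      using convex_subset_S_coset s sub P'(1) convex(2) by blast
    moreover have "gated_subset W S (s <# P')"
      using gated_subset_S_coset [OF s sub [OF P'(1)] gated(2)]
        refinable_coset_descents [OF \<Q>(1,2) ref P'] by blast
    moreover have "s <# P' \<subseteq> carrier W"
      using mem_S_coset_iff s sub P'(1) by blast
    ultimately show ?thesis
      unfolding X_eq using convex_subset_Int gated_subset_Int [of P "s <# P'"] convex(1) gated(1)
        sub [OF P] nonempty [OF X] X_eq by blast
  qed
  then show "convex_partition W S (simple_refinement W \<Q> P s)"
    "gated_partition W S (simple_refinement W \<Q> P s)"
    by (simp_all add: convex_partition_def gated_partition_def)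
qed

text \<open>If a part \<open>X\<close> of \<open>\<R>\<close> lies in \<open>P\<close>, regularity
  puts \<open>s <# X\<close> into one part of \<open>\<R>\<close>, hence into one part
  \<open>P'\<close> of \<open>\<Q>\<close>. Thus \<open>X\<close> lies in the single piece
  \<open>P \<inter> (s <# P')\<close>.\<close>

lemma refines_simple_refinement:
  assumes \<R>: "refines (carrier W) \<R> \<Q>" "regular W S \<R>"
    and \<Q>: "locally_constant W S \<Q>" and ref: "refinable_at W S \<Q> P s"
  shows "refines (carrier W) \<R> (simple_refinement W \<Q> P s)"
proof -
  have part: "partition_on (carrier W) \<R>" "partition_on (carrier W) \<Q>"
    and finer: "\<And>X. X \<in> \<R> \<Longrightarrow> \<exists>Q\<in>\<Q>. X \<subseteq> Q"
    using \<R>(1) by (auto simp: refines_def)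
  have s: "s \<in> S" and P: "P \<in> \<Q>" and desc_P: "s \<notin> part_descents W S P"
    using ref by (auto simp: refinable_at_def)
  have sub: "\<And>X. X \<in> \<Q> \<Longrightarrow> X \<subseteq> carrier W"
    using part(2) by (auto simp: partition_on_def)
  have "\<exists>Y\<in>simple_refinement W \<Q> P s. X \<subseteq> Y" if X: "X \<in> \<R>" for X
  proof -
    obtain Q where Q: "Q \<in> \<Q>" "X \<subseteq> Q"
      using finer X by blast
    obtain x where x: "x \<in> X"
      using partition_onD3 [OF part(1)] X by (metis ex_in_conv)
    show ?thesis
    proof (cases "Q = P")
      case False
      then show ?thesis
        using Q unfolding simple_refinement_def by blast
    next
      case True
      have "part_descents W S X = part_descents W S P"
        using part_descents_eq [of \<R> X x] part_descents_eq [OF \<Q> P, of x] \<R>(2) X x Q True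
        unfolding regular_def by blast
      then have "s \<in> S - part_descents W S X"
        using s desc_P by blast
      then obtain X' where X': "X' \<in> \<R>" "s <# X \<subseteq> X'"
        using \<R>(2) X unfolding regular_def by blast
      obtain P' where P': "P' \<in> \<Q>" "X' \<subseteq> P'"
        using finer X'(1) by blast
      have "X \<subseteq> P \<inter> (s <# P')"
      proof
        fix y
        assume y: "y \<in> X"
        then have "s \<otimes> y \<in> P'"
          using X' P' unfolding l_coset_def by blast
        then show "y \<in> P \<inter> (s <# P')"
          using mem_S_coset_iff [OF s sub [OF P'(1)]] y Q True sub [OF P] by blast
      qed
      moreover have "s \<otimes> x \<in> P' \<inter> (s <# P)"
        using x X' P' Q True unfolding l_coset_def by blast
      ultimately show ?thesis
        using P'(1) unfolding simple_refinement_def by blast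
    qed
  qed
  then show ?thesis
    using part(1) partition_on_simple_refinement [OF part(2) P s] unfolding refines_def by blast
qed

section \<open>Starting partition and regular completion\<close>

lemma partition_on_descent_partition: "partition_on (carrier W) (descent_partition W S)"
  by (rule partition_onI) (auto simp: descent_partition_def disjnt_def)

text \<open>Local constancy says that \<open>\<P>\<close> already refines the descent partition, so
  the coarsest common refinement is \<open>\<P>\<close> itself.\<close>

lemma initial_partition_eq:
  assumes \<P>: "partition_on (carrier W) \<P>" "locally_constant W S \<P>"
  shows "initial_partition W S \<P> = \<P>"
proof -
  have parts: "\<And>\<Q>. \<Q> \<in> {\<P>, descent_partition W S} \<Longrightarrow> partition_on (carrier W) \<Q>"
    using \<P>(1) partition_on_descent_partition by blast
  have "\<exists>Y\<in>descent_partition W S. X \<subseteq> Y" if X: "X \<in> \<P>" for X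
  proof -
    have sub: "X \<subseteq> carrier W" and "X \<noteq> {}"
      using X \<P>(1) by (auto simp: partition_on_def)
    then obtain x where x: "x \<in> X" "x \<in> carrier W"
      by blast
    then have "X \<subseteq> {y \<in> carrier W. left_descents W S y = left_descents W S x}"
      using sub X \<P>(2) unfolding locally_constant_def by blast
    then show ?thesis
      using x unfolding descent_partition_def by blast
  qed
  then have "refines (carrier W) \<P> (descent_partition W S)"
    using \<P>(1) partition_on_descent_partition by (simp add: refines_def)
  then have "refines (carrier W) \<P> (initial_partition W S \<P>)"
    unfolding initial_partition_def
    by (intro common_refinement_coarsest) (use parts \<P>(1) refines_refl in auto)
  moreover have "refines (carrier W) (initial_partition W S \<P>) \<P>"
    unfolding initial_partition_def by (rule refines_common_refinement) (use parts in auto)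
  ultimately show ?thesis
    using refines_asym by blast
qed

text \<open>\<open>\<Q>\<close> belongs to the family whose meet is taken and is a lower bound of
  it, so any greatest lower bound equals \<open>\<Q>\<close> by antisymmetry.\<close>

lemma regular_completion_eqI:
  assumes \<Q>: "regular W S \<Q>" "refines (carrier W) \<Q> \<P>"
    and least: "\<And>\<R>. \<lbrakk>regular W S \<R>; refines (carrier W) \<R> \<P>\<rbrakk> \<Longrightarrow> refines (carrier W) \<R> \<Q>"
  shows "regular_completion W S \<P> = \<Q>"
proof -
  let ?L = "regular_partitions W S"
  let ?A = "{\<R> \<in> carrier ?L. partition_le W \<P> \<R>}"
  \<comment> \<open>The lattice order runs against refinement: larger partitions are finer.\<close>
  have le: "le ?L = (\<lambda>X Y. refines (carrier W) Y X)"
    by (intro ext) (simp add: regular_partitions_def partition_le_def)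
  have L: "\<R> \<in> carrier ?L \<longleftrightarrow> partition_on (carrier W) \<R> \<and> regular W S \<R>" for \<R>
    by (simp add: regular_partitions_def)
  have A: "\<R> \<in> ?A \<longleftrightarrow> regular W S \<R> \<and> refines (carrier W) \<R> \<P>" for \<R>
    unfolding L mem_Collect_eq partition_le_def refines_def by blast
  have QL: "\<Q> \<in> carrier ?L"
    using \<Q> unfolding L refines_def by blast
  have lower: "X \<in> Lower ?L ?A \<longleftrightarrow> X \<in> carrier ?L \<and> (\<forall>\<R>\<in>?A. refines (carrier W) \<R> X)" for X
    unfolding Lower_def le by blast
  have Q_lower: "\<Q> \<in> Lower ?L ?A"
    unfolding lower using QL least A by blast
  have QA: "\<Q> \<in> ?A"
    unfolding A using \<Q> by blast
  have above: "refines (carrier W) \<Q> X" if "X \<in> Lower ?L ?A" for X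
    using that QA unfolding lower by blast
  \<comment> \<open>The meet is defined by choice, so \<open>\<Q>\<close> is shown to be the only
    candidate.\<close>
  have "greatest ?L X (Lower ?L ?A) \<longleftrightarrow> X = \<Q>" for X
  proof
    assume X: "greatest ?L X (Lower ?L ?A)"
    then have "refines (carrier W) X \<Q>"
      using Q_lower unfolding greatest_def le by blast
    moreover have "refines (carrier W) \<Q> X"
      using X above unfolding greatest_def by blast
    ultimately show "X = \<Q>"
      using refines_asym by blast
  next
    assume X: "X = \<Q>"
    show "greatest ?L X (Lower ?L ?A)"
      unfolding greatest_def le X using Q_lower above by (auto simp: Lower_def)
  qed
  then show ?thesis
    unfolding regular_completion_def inf_def by simp
qed

section \<open>Invariants along a terminating run\<close>

lemma regular_completion_gated_convex:
  assumes \<P>: "partition_on (carrier W) \<P>" "locally_constant W S \<P>"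
      "convex_partition W S \<P>" "gated_partition W S \<P>"
    and run: "terminating_run W S \<P> n Ps"
  shows "gated_partition W S (regular_completion W S \<P>)
    \<and> convex_partition W S (regular_completion W S \<P>)"
proof -
  \<comment> \<open>The last conjunct keeps every step coarser than all regular refinements of
    \<open>\<P>\<close>; at step \<open>n\<close> it gives minimality.\<close>
  have inv: "partition_on (carrier W) (Ps j) \<and> locally_constant W S (Ps j) \<and>
      convex_partition W S (Ps j) \<and> gated_partition W S (Ps j) \<and>
      refines (carrier W) (Ps j) \<P> \<and>
      (\<forall>\<R>. regular W S \<R> \<longrightarrow> refines (carrier W) \<R> \<P> \<longrightarrow> refines (carrier W) \<R> (Ps j))"
    if "j \<le> n" for j
    using that
  proof (induction j)
    case 0
    have "Ps 0 = \<P>"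
      using run initial_partition_eq \<P> by (simp add: terminating_run_def)
    then show ?case
      using \<P> refines_refl by simp
  next
    case (Suc j)
    then have IH: "partition_on (carrier W) (Ps j)" "locally_constant W S (Ps j)"
      "convex_partition W S (Ps j)" "gated_partition W S (Ps j)"
      "refines (carrier W) (Ps j) \<P>"
      "\<And>\<R>. \<lbrakk>regular W S \<R>; refines (carrier W) \<R> \<P>\<rbrakk> \<Longrightarrow> refines (carrier W) \<R> (Ps j)"
      by simp_all
    obtain P s where ref: "refinable_at W S (Ps j) P s"
      and step: "Ps (Suc j) = simple_refinement W (Ps j) P s"
      using run Suc.prems unfolding terminating_run_def by (metis Suc_le_eq)
    have P: "P \<in> Ps j" and s: "s \<in> S"
      using ref by (auto simp: refinable_at_def)
    have part: "partition_on (carrier W) (Ps (Suc j))"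
      unfolding step by (rule partition_on_simple_refinement) fact+
    have "refines (carrier W) (Ps (Suc j)) (Ps j)"
      using part IH(1) P unfolding refines_def step simple_refinement_def by blast
    then have "refines (carrier W) (Ps (Suc j)) \<P>"
      using IH(5) refines_trans by blast
    then show ?case
      using part simple_refinement_preserves [OF IH(1-4) ref]
        refines_simple_refinement [OF IH(6) _ IH(2) ref] unfolding step by blast
  qed
  \<comment> \<open>Together with local constancy, the absence of a refinable pair is exactly
    regularity.\<close>
  have "regular W S (Ps n)"
    using inv [of n] run unfolding terminating_run_def regular_def refinable_at_def by blast
  then have "regular_completion W S \<P> = Ps n"
    using inv [of n] by (intro regular_completion_eqI) blast+
  then show ?thesis
    using inv [of n] by simp
qed

end

theorem theorem5:
  fixes W :: "('a, 'b) monoid_scheme" and S :: "'a set" and \<P> :: "'a set set"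
    and n :: nat and Ps :: "nat \<Rightarrow> 'a set set"
  assumes "coxeter_system W S" and "finite S"
    and "partition_on (carrier W) \<P>"
    and "locally_constant W S \<P>" and "convex_partition W S \<P>" and "gated_partition W S \<P>"
    and "terminating_run W S \<P> n Ps"
  shows "gated_partition W S (regular_completion W S \<P>)
    \<and> convex_partition W S (regular_completion W S \<P>)"
  using coxeter_group.regular_completion_gated_convex
    [OF coxeter_system_imp_coxeter_group [OF assms(1)] assms(3-7)] .

end
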